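(* Let $q$ be a complex number with $0<|q|<1$, and for $r\in\{1,7\}$ put $$w_r:=q^{r/2}\frac{f_rf_{21r}}{f_{3r}f_{7r}}.$$ If $P:=w_1w_7$ and $Q:=\dfrac{w_1}{w_7}$, then $$\begin{aligned} P^6+\frac{1}{P^6}+Q^4+\frac{1}{Q^4}={}&49\left(Q^2+\frac{1}{Q^2}\right)-28\left(Q+\frac{1}{Q}\right)-464\\ &+\left(P^5+\frac{1}{P^5}\right)\left[29+7\left(Q+\frac{1}{Q}\right)\right]-\left(P^4+\frac{1}{P^4}\right)\left[106+14\left(Q+\frac{1}{Q}\right)\right]\\ &+\left(P^3+\frac{1}{P^3}\right)\left[183+21\left(Q+\frac{1}{Q}\right)-7\left(Q^3+\frac{1}{Q^3}\right)+\left(Q^4+\frac{1}{Q^4}\right)\right]\\ &-\left(P^2+\frac{1}{P^2}\right)\left[260+28\left(Q+\frac{1}{Q}\right)-49\left(Q^2+\frac{1}{Q^2}\right)+\left(Q^4+\frac{1}{Q^4}\right)\right]\\ &+\left(P+\frac{1}{P}\right)\left[337+35\left(Q+\frac{1}{Q}\right)-49\left(Q^2+\frac{1}{Q^2}\right)+\left(Q^4+\frac{1}{Q^4}\right)\right]. \end{aligned}$$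
   Context: For $|q|<1$, $f(-q):=\sum_{n=-\infty}^{\infty}(-1)^n q^{n(3n-1)/2}$, and $f_n:=f(-q^n)$ for positive integers $n$ (so $f_n$ is $f(-x)$ evaluated at $x=q^n$). A square root $q^{1/2}$ of $q$ is fixed (the positive one if $0<q<1$) and $q^{r/2}:=(q^{1/2})^r$. *)

theory Defs
  imports "HOL-Analysis.Analysis"
begin

(* ram_f q is Ramanujan's f(-q); the sign is part of the definition.
   The exponent n(3n-1)/2 is a nonnegative integer for every integer n, so div is exact. *)
definition ram_f :: "complex \<Rightarrow> complex" where
  "ram_f q = (\<Sum>\<^sub>\<infinity>n::int. (-1) powi n * q powi (n * (3 * n - 1) div 2))"

definition ram_fn :: "complex \<Rightarrow> nat \<Rightarrow> complex" where
  "ram_fn q n = ram_f (q ^ n)"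

(* The argument s stands for the fixed square root of q, so q^(r/2) is s ^ r. *)
definition w_quot :: "complex \<Rightarrow> complex \<Rightarrow> nat \<Rightarrow> complex" where
  "w_quot q s r =
     s ^ r * (ram_fn q r * ram_fn q (21 * r)) / (ram_fn q (3 * r) * ram_fn q (7 * r))"

end

theory Submission
  imports Defs "HOL-Probability.Characteristic_Functions" "HOL-Complex_Analysis.Complex_Analysis"
begin

text \<open>
  Put $a = \eta(\tau)/\eta(3\tau)$, $b = \eta(7\tau)/\eta(21\tau)$ and $w_1 = a/b$. Everything follows from Ramanujan's relation
  \[ (ab)^3 + 27 (ab)^{-3} = w_1^{-4} - 7 w_1^{-2} + 7 w_1^2 - w_1^4. \]
  Written at $q$ and at $q^7$ it involves the common unknown $b^6$. Eliminating it gives $(P+1)^2/P$ times the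
  asserted identity, and $P + 1$ does not vanish for small $q$, so the identity follows by analytic continuation.

  The relation itself says that a polynomial of degree 16 in $\eta(\tau), \eta(3\tau), \eta(7\tau), \eta(21\tau)$ vanishes.
  Its absolute value times $(\Im\tau)^4$ is invariant under translation, reflection and three involutions, whose
  isometric circles suffice to move every point to height at least $0.04$. Since the form vanishes at
  infinity to order $49/3$, the maximum modulus principle forces it to be zero. The transformation law of $\eta$ is
  Poisson summation for Gaussians, continued from the imaginary axis.
\<close>

section \<open>Poisson summation for Gaussians\<close>

text \<open>Each monomial of the form has 16 eta factors, hence weight 8, and the leading power is
  q^(80/24) = q^(10/3). The order 49/3 is this plus the 13 coefficients that are checked to cancel.
  Why 13: if the form vanishes to order N at infinity, the maximum principle leaves the factor y^4
  e^(-2 pi N y), which decreases only from y = 2/(pi N) on. That value has to lie below the height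
  to which every point can be moved, and the corners left by the isometric circles have height sqrt
  3/42 = 0.0412. N = 49/3 gives 0.0390, whereas N = 46/3 gives 0.0415. Absolute values remove the
  multiplier that the four eta values have in common. Their relative phases remain, since they enter
  the six monomials with different exponents; finding them, with the right branches of the square
  roots, is the main labour in the invariance under the involutions. Together the involutions carry
  every cusp of level 21 to infinity, so one expansion is enough.\<close>

lemma cos_mult_cos_shift:
  "cos (2 * pi * x) * cos (2 * pi * of_int m * x) =
     (cos (2 * pi * of_int (m + 1) * x) + cos (2 * pi * of_int (m - 1) * x)) / (2::real)"
  "cos (2 * pi * x) * sin (2 * pi * of_int m * x) =
     (sin (2 * pi * of_int (m + 1) * x) + sin (2 * pi * of_int (m - 1) * x)) / (2::real)"
  "sin (2 * pi * x) * cos (2 * pi * of_int m * x) =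
     (sin (2 * pi * of_int (m + 1) * x) - sin (2 * pi * of_int (m - 1) * x)) / (2::real)"
  "sin (2 * pi * x) * sin (2 * pi * of_int m * x) =
     (cos (2 * pi * of_int (m - 1) * x) - cos (2 * pi * of_int (m + 1) * x)) / (2::real)"
proof -
  have "2 * pi * of_int (m + 1) * x = 2 * pi * of_int m * x + 2 * pi * x"
       "2 * pi * of_int (m - 1) * x = 2 * pi * of_int m * x - 2 * pi * x"
    by (simp_all add: algebra_simps)
  thus "cos (2 * pi * x) * cos (2 * pi * of_int m * x) =
     (cos (2 * pi * of_int (m + 1) * x) + cos (2 * pi * of_int (m - 1) * x)) / (2::real)"
  "cos (2 * pi * x) * sin (2 * pi * of_int m * x) =
     (sin (2 * pi * of_int (m + 1) * x) + sin (2 * pi * of_int (m - 1) * x)) / (2::real)"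
  "sin (2 * pi * x) * cos (2 * pi * of_int m * x) =
     (sin (2 * pi * of_int (m + 1) * x) - sin (2 * pi * of_int (m - 1) * x)) / (2::real)"
  "sin (2 * pi * x) * sin (2 * pi * of_int m * x) =
     (cos (2 * pi * of_int (m - 1) * x) - cos (2 * pi * of_int (m + 1) * x)) / (2::real)"
    by (simp_all only: sin_add sin_diff cos_add cos_diff) (simp_all add: algebra_simps)
qed

text \<open>Transported to the unit circle via \<open>cis\<close>, trigonometric polynomials become real polynomials in the
  real and imaginary part, so the Stone--Weierstrass theorem applies to \<open>d\<close> itself.\<close>

lemma fourier_coeffs_zero_imp_zero:
  fixes d :: "real \<Rightarrow> real"
  assumes cont: "continuous_on {0..1} d" and per: "d 0 = d 1"
    and cos0: "\<And>m::int. integral {0..1} (\<lambda>x. d x * cos (2 * pi * of_int m * x)) = 0"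
    and sin0: "\<And>m::int. integral {0..1} (\<lambda>x. d x * sin (2 * pi * of_int m * x)) = 0"
    and x: "x \<in> {0..1}"
  shows "d x = 0"
proof -
  \<comment> \<open>\<open>C\<close> collects the multipliers h for which d * h still has vanishing
    Fourier coefficients. The product-to-sum formulas only shift the frequency m by one, so
    \<open>C\<close> is closed under multiplication by cos(2 pi x) and sin(2 pi x), hence by every
    trigonometric polynomial.\<close>
  define C where "C = {h. continuous_on {0..1} h \<and>
     (\<forall>m::int. integral {0..1} (\<lambda>x. d x * h x * cos (2 * pi * of_int m * x)) = 0 \<and>
               integral {0..1} (\<lambda>x. d x * h x * sin (2 * pi * of_int m * x)) = 0)}"
  have C_add: "(\<lambda>x. h1 x + h2 x) \<in> C" if "h1 \<in> C" "h2 \<in> C" for h1 h2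
  proof -
    have c: "continuous_on {0..1} h1" "continuous_on {0..1} h2" using that by (auto simp: C_def)
    have "integral {0..1} (\<lambda>x. d x * (h1 x + h2 x) * cos (2 * pi * of_int m * x)) = 0" 
         "integral {0..1} (\<lambda>x. d x * (h1 x + h2 x) * sin (2 * pi * of_int m * x)) = 0" for m :: int
      using that 
      by (simp_all add: C_def algebra_simps integral_add integrable_continuous_real continuous_intros c cont)
    thus ?thesis using c by (auto simp: C_def intro!: continuous_intros)
  qed
  have C_cmult: "(\<lambda>x. a * h x) \<in> C" if "h \<in> C" for h a
  proof -
    have c: "continuous_on {0..1} h" using that by (auto simp: C_def)
    have *: "(\<lambda>x. d x * (a * h x) * z x) = (\<lambda>x. a * (d x * h x * z x))" for z by auto
    show ?thesis using that c unfolding C_def mem_Collect_eq * by (auto intro!: continuous_intros)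
  qed
  have C_cos: "(\<lambda>x. cos (2 * pi * x) * h x) \<in> C" if "h \<in> C" for h
  proof -
    have c: "continuous_on {0..1} h" using that by (auto simp: C_def)
    have **: "d x * (cos (2 * pi * x) * h x) * cos (2 * pi * of_int m * x) =
          (d x * h x * cos (2 * pi * of_int (m + 1) * x) + d x * h x * cos (2 * pi * of_int (m - 1) * x)) / 2"
        "d x * (cos (2 * pi * x) * h x) * sin (2 * pi * of_int m * x) =
          (d x * h x * sin (2 * pi * of_int (m + 1) * x) + d x * h x * sin (2 * pi * of_int (m - 1) * x)) / 2" for x and m :: int
      using cos_mult_cos_shift[of x m] by (algebra, algebra)
    have *: "(\<lambda>x. d x * (cos (2 * pi * x) * h x) * cos (2 * pi * of_int m * x)) =
          (\<lambda>x. (d x * h x * cos (2 * pi * of_int (m + 1) * x) + d x * h x * cos (2 * pi * of_int (m - 1) * x)) / 2)"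
        "(\<lambda>x. d x * (cos (2 * pi * x) * h x) * sin (2 * pi * of_int m * x)) =
          (\<lambda>x. (d x * h x * sin (2 * pi * of_int (m + 1) * x) + d x * h x * sin (2 * pi * of_int (m - 1) * x)) / 2)" for m :: int
      by (simp_all only: **)
    have "integral {0..1} (\<lambda>x. d x * h x * cos (2 * pi * of_int (m + 1) * x) + d x * h x * cos (2 * pi * of_int (m - 1) * x)) = 0"
         "integral {0..1} (\<lambda>x. d x * h x * sin (2 * pi * of_int (m + 1) * x) + d x * h x * sin (2 * pi * of_int (m - 1) * x)) = 0"
        for m :: int
      by ((subst integral_add;
           use that in \<open>auto simp: C_def simp del: of_int_add of_int_diff
                         intro!: integrable_continuous_real continuous_intros c cont\<close>),
          (subst integral_add;
           use that in \<open>auto simp: C_def simp del: of_int_add of_int_diff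
                         intro!: integrable_continuous_real continuous_intros c cont\<close>))
    thus ?thesis using c unfolding C_def mem_Collect_eq *
      by (auto intro!: continuous_intros simp del: of_int_add of_int_diff)
  qed
  have C_sin: "(\<lambda>x. sin (2 * pi * x) * h x) \<in> C" if "h \<in> C" for h
  proof -
    have c: "continuous_on {0..1} h" using that by (auto simp: C_def)
    have **: "d x * (sin (2 * pi * x) * h x) * cos (2 * pi * of_int m * x) =
          (d x * h x * sin (2 * pi * of_int (m + 1) * x) - d x * h x * sin (2 * pi * of_int (m - 1) * x)) / 2"
        "d x * (sin (2 * pi * x) * h x) * sin (2 * pi * of_int m * x) =
          (d x * h x * cos (2 * pi * of_int (m - 1) * x) - d x * h x * cos (2 * pi * of_int (m + 1) * x)) / 2" for x and m :: int
      using cos_mult_cos_shift[of x m] by (algebra, algebra)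
    have *: "(\<lambda>x. d x * (sin (2 * pi * x) * h x) * cos (2 * pi * of_int m * x)) =
          (\<lambda>x. (d x * h x * sin (2 * pi * of_int (m + 1) * x) - d x * h x * sin (2 * pi * of_int (m - 1) * x)) / 2)"
        "(\<lambda>x. d x * (sin (2 * pi * x) * h x) * sin (2 * pi * of_int m * x)) =
          (\<lambda>x. (d x * h x * cos (2 * pi * of_int (m - 1) * x) - d x * h x * cos (2 * pi * of_int (m + 1) * x)) / 2)" for m :: int
      by (simp_all only: **)
    have "integral {0..1} (\<lambda>x. d x * h x * sin (2 * pi * of_int (m + 1) * x) - d x * h x * sin (2 * pi * of_int (m - 1) * x)) = 0"
         "integral {0..1} (\<lambda>x. d x * h x * cos (2 * pi * of_int (m - 1) * x) - d x * h x * cos (2 * pi * of_int (m + 1) * x)) = 0"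
        for m :: int
      by ((subst integral_diff;
           use that in \<open>auto simp: C_def simp del: of_int_add of_int_diff
                         intro!: integrable_continuous_real continuous_intros c cont\<close>),
          (subst integral_diff;
           use that in \<open>auto simp: C_def simp del: of_int_add of_int_diff
                         intro!: integrable_continuous_real continuous_intros c cont\<close>))
    thus ?thesis using c unfolding C_def mem_Collect_eq *
      by (auto intro!: continuous_intros simp del: of_int_add of_int_diff)
  qed
  have poly: "\<forall>h\<in>C. (\<lambda>x. g (cis (2 * pi * x)) * h x) \<in> C" if "real_polynomial_function g" for g
    using that
  proof induction
    case (linear f)
    have "f (cis y) = cos y * f 1 + sin y * f \<i>" for y
    proof -
      interpret bounded_linear f by fact
      have "cis y = cos y *\<^sub>R 1 + sin y *\<^sub>R \<i>" by (simp add: complex_eq_iff)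
      thus ?thesis by (simp add: add scaleR)
    qed
    hence *: "f (cis (2 * pi * x)) * h x = f 1 * (cos (2 * pi * x) * h x) + f \<i> * (sin (2 * pi * x) * h x)" 
      for x and h :: "real \<Rightarrow> real" by (simp add: algebra_simps)
    show ?case unfolding * by (intro ballI C_add C_cmult C_cos C_sin)
  next
    case (mult f g)
    thus ?case by (simp add: mult.assoc)
  next
    case (add f g)
    thus ?case by (simp add: ring_distribs C_add)
  qed (auto intro: C_cmult)
  have one: "(\<lambda>_. 1) \<in> C" using cos0 sin0 by (simp add: C_def)
  \<comment> \<open>\<open>Arg2pi\<close> jumps at 1, and d 0 = d 1 is what makes \<open>D\<close>
    continuous there. The continuity is read off from the trivial homotopy of the loop d with
    itself.\<close>
  define D where "D = d \<circ> (\<lambda>z. Arg2pi z / (2 * pi))"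
  have "homotopic_loops UNIV d d"
    by (simp add: homotopic_loops_refl cont per path_def pathstart_def pathfinish_def path_image_def)
  hence contD: "continuous_on (sphere 0 1) D"
    unfolding D_def by (metis homotopic_loops_imp_homotopic_circlemaps homotopic_with_imp_continuous)
  have D: "D (cis (2 * pi * x)) = d x" if "x \<in> {0..1}" for x
  proof (cases "x = 1")
    case True
    have "Arg2pi 1 = 0" by (rule Arg2pi_unique[of 1]) auto
    thus ?thesis using True per by (simp add: D_def cis_2pi)
  next
    case False
    hence "2 * pi * x < 2 * pi * 1" using that by (intro mult_strict_left_mono) auto
    hence "Arg2pi (cis (2 * pi * x)) = 2 * pi * x"
      using that by (intro Arg2pi_unique[where r=1]) (auto simp: cis_conv_exp)
    thus ?thesis by (simp add: D_def)
  qed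
  define B where "B = integral {0..1} (\<lambda>x. \<bar>d x\<bar>)"
  have B0: "B \<ge> 0" unfolding B_def by (rule integral_nonneg) (auto intro!: integrable_continuous_real continuous_intros cont)
  \<comment> \<open>Because d is orthogonal to the trigonometric polynomial h, the integral of d^2
    equals that of d * (d - h), which is at most e * B once h approximates d within e.\<close>
  have small: "integral {0..1} (\<lambda>x. d x ^ 2) \<le> e * B" if e: "e > 0" for e
  proof -
    obtain g where g: "real_polynomial_function g" "\<And>z. z \<in> sphere 0 1 \<Longrightarrow> \<bar>D z - g z\<bar> < e"
      using Stone_Weierstrass_real_polynomial_function[OF compact_sphere contD e] by metis
    define h where "h = (\<lambda>x. g (cis (2 * pi * x)))"
    have h: "h \<in> C" using poly[OF g(1)] one by (auto simp: h_def)
    have hc: "continuous_on {0..1} h" using h by (simp add: C_def)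
    have h0: "integral {0..1} (\<lambda>x. d x * h x) = 0"
      using h by (auto simp: C_def dest: spec[of _ "0::int"])
    have "integral {0..1} (\<lambda>x. d x ^ 2) = integral {0..1} (\<lambda>x. d x ^ 2) - integral {0..1} (\<lambda>x. d x * h x)"
      using h0 by simp
    also have "\<dots> = integral {0..1} (\<lambda>x. d x ^ 2 - d x * h x)"
      by (rule integral_diff [symmetric]) (auto intro!: integrable_continuous_real continuous_intros cont hc)
    also have "\<dots> \<le> integral {0..1} (\<lambda>x. e * \<bar>d x\<bar>)"
    proof (rule integral_le)
      fix x :: real assume x: "x \<in> {0..1}"
      have "\<bar>d x - h x\<bar> \<le> e" using g(2)[of "cis (2 * pi * x)"] D[OF x] by (simp add: h_def)
      hence "d x * (d x - h x) \<le> \<bar>d x\<bar> * e" 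
        by (metis abs_ge_self abs_mult mult_left_mono abs_ge_zero order_trans)
      thus "d x ^ 2 - d x * h x \<le> e * \<bar>d x\<bar>" by (simp add: power2_eq_square algebra_simps)
    qed (auto intro!: integrable_continuous_real continuous_intros cont hc)
    finally show ?thesis by (simp add: B_def)
  qed
  have "integral {0..1} (\<lambda>x. d x ^ 2) \<le> 0"
  proof (rule field_le_epsilon)
    fix e :: real assume e: "e > 0"
    have "integral {0..1} (\<lambda>x. d x ^ 2) \<le> (e / (B + 1)) * B" using small[of "e / (B+1)"] B0 e by simp
    also have "\<dots> \<le> e" using B0 e by (simp add: field_simps)
    finally show "integral {0..1} (\<lambda>x. d x ^ 2) \<le> 0 + e" by simp
  qed
  moreover have "integral {0..1} (\<lambda>x. d x ^ 2) \<ge> 0"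
    by (rule integral_nonneg) (auto intro!: integrable_continuous_real continuous_intros cont)
  ultimately have "integral {0..1} (\<lambda>x. d x ^ 2) = 0" by simp
  hence "\<forall>x\<in>{0..1}. d x ^ 2 = 0"
    by (subst (asm) integral_eq_0_iff) (auto intro!: continuous_intros cont)
  thus ?thesis using x by simp
qed

section \<open>Gaussian integrals, termwise integration and unfolding\<close>

lemma gaussian_cos_integral:
  fixes t a :: real
  assumes t: "t > 0"
  shows "integrable lborel (\<lambda>x. exp (- pi * x ^ 2 / t) * cos (a * x))"
    and "(LBINT x. exp (- pi * x ^ 2 / t) * cos (a * x)) = sqrt t * exp (- (a ^ 2) * t / (4 * pi))"
proof -
  have i1: "integrable lborel (\<lambda>x. std_normal_density x *\<^sub>R iexp (u * x))" for u
  proof -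
    have "integrable std_normal_distribution (\<lambda>x. iexp (u * x))"
      by (rule prob_space.integrable_iexp) (auto intro: prob_space_normal_density)
    thus ?thesis
      by (subst (asm) integrable_density) auto
  qed
  have i2: "(LBINT x. std_normal_density x *\<^sub>R iexp (u * x)) = of_real (exp (- (u ^ 2) / 2))" for u
  proof -
    have "char std_normal_distribution u = (LBINT x. std_normal_density x *\<^sub>R iexp (u * x))"
      unfolding char_def by (subst integral_density) auto
    thus ?thesis by (simp add: char_std_normal_distribution)
  qed
  have re: "Re (std_normal_density x *\<^sub>R iexp (u * x)) = std_normal_density x * cos (u * x)" for x u
    by (simp add: Re_exp)
  have j1: "integrable lborel (\<lambda>x. std_normal_density x * cos (u * x))" for u
    using integrable_Re[OF i1[of u]] unfolding re .
  have j2: "(LBINT x. std_normal_density x * cos (u * x)) = exp (- (u ^ 2) / 2)" for u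
    using integral_Re[OF i1[of u]] unfolding re i2 by simp
  \<comment> \<open>Chosen so that (c x)^2 / 2 = pi x^2 / t: the substitution reduces the claim to
    the characteristic function of the standard normal distribution.\<close>
  define c where "c = sqrt (2 * pi / t)"
  have c: "c > 0" "c ^ 2 = 2 * pi / t" using t by (auto simp: c_def)
  have eq: "std_normal_density (c * x) * cos (a / c * (c * x)) = 
        (exp (- pi * x ^ 2 / t) * cos (a * x)) / sqrt (2 * pi)" for x
  proof -
    have "(c * x)\<^sup>2 / 2 = pi * x ^ 2 / t" using c by (simp add: power_mult_distrib)
    thus ?thesis using c by (simp add: std_normal_density_def)
  qed
  have "integrable lborel (\<lambda>x. std_normal_density (0 + c * x) * cos (a / c * (0 + c * x)))"
    using c(1) by (intro lborel_integrable_real_affine j1) auto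
  hence "integrable lborel (\<lambda>x. (exp (- pi * x ^ 2 / t) * cos (a * x)) / sqrt (2 * pi))"
    unfolding add_0 eq .
  from integrable_mult_right[OF this, of "sqrt (2 * pi)"]
  show "integrable lborel (\<lambda>x. exp (- pi * x ^ 2 / t) * cos (a * x))" by simp
  have "exp (- ((a / c) ^ 2) / 2) = c * (LBINT x. std_normal_density (0 + c * x) * cos (a / c * (0 + c * x)))"
    using c(1) by (subst j2 [symmetric], subst lborel_integral_real_affine[of c _ 0]) auto
  also have "\<dots> = c * ((LBINT x. exp (- pi * x ^ 2 / t) * cos (a * x)) / sqrt (2 * pi))"
    unfolding add_0 eq by simp
  finally have "(LBINT x. exp (- pi * x ^ 2 / t) * cos (a * x)) = sqrt (2 * pi) / c * exp (- ((a / c) ^ 2) / 2)"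
    using c(1) by (simp add: field_simps)
  also have "sqrt (2 * pi) / c = sqrt t" using t by (simp add: c_def real_sqrt_divide)
  also have "- ((a / c) ^ 2) / 2 = - (a ^ 2) * t / (4 * pi)" using t by (simp add: power_divide c)
  finally show "(LBINT x. exp (- pi * x ^ 2 / t) * cos (a * x)) = sqrt t * exp (- (a ^ 2) * t / (4 * pi))" .
qed

lemma summable_on_gaussian_int:
  fixes c :: real
  assumes c: "c > 0"
  shows "(\<lambda>n::int. exp (- c * of_int n ^ 2)) summable_on UNIV"
proof -
  have nat: "(\<lambda>n::nat. exp (- c * of_nat n ^ 2)) summable_on UNIV"
  proof (rule summable_on_comparison_test)
    show "(\<lambda>n::nat. exp (-c) ^ n) summable_on UNIV"
      using c by (intro summable_nonneg_imp_summable_on summable_geometric) auto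
    fix n :: nat
    have "c * real n \<le> c * real n ^ 2" using c by (intro mult_left_mono) (cases n, auto simp: power2_eq_square)
    thus "exp (- c * of_nat n ^ 2) \<le> exp (-c) ^ n" by (simp add: exp_of_nat_mult [symmetric] mult_ac)
  qed auto
  have "(\<lambda>n::int. exp (- c * of_int n ^ 2)) summable_on (range int \<union> range (\<lambda>n. - int n))"
    by (intro summable_on_union; subst summable_on_reindex) (use nat in \<open>auto simp: o_def inj_on_def\<close>)
  also have "range int \<union> range (\<lambda>n. - int n) = UNIV"
  proof -
    have "x \<in> range int \<union> range (\<lambda>n. - int n)" for x
      by (cases x rule: int_cases2) auto
    thus ?thesis by blast
  qed
  finally show ?thesis .
qed

text \<open>The Weierstrass M-test gives a uniform limit along the filter of finite subsets. This is
  also the filter behind \<open>has_sum\<close>, so the integers need no enumeration for termwise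
  integration.\<close>

lemma series_integral_01:
  fixes f :: "int \<Rightarrow> real \<Rightarrow> real"
  assumes cont: "\<And>n. continuous_on {0..1} (f n)"
    and M: "\<And>n x. x \<in> {0..1} \<Longrightarrow> \<bar>f n x\<bar> \<le> M n" and sM: "M summable_on UNIV"
  shows "continuous_on {0..1} (\<lambda>x. \<Sum>\<^sub>\<infinity>n. f n x)"
    and "((\<lambda>n. integral {0..1} (f n)) has_sum integral {0..1} (\<lambda>x. \<Sum>\<^sub>\<infinity>n. f n x)) UNIV"
    and "x \<in> {0..1} \<Longrightarrow> ((\<lambda>n. f n x) has_sum (\<Sum>\<^sub>\<infinity>n. f n x)) UNIV"
proof -
  have u: "uniform_limit {0..1} (\<lambda>X x. \<Sum>n\<in>X. f n x) (\<lambda>x. \<Sum>\<^sub>\<infinity>n. f n x) (finite_subsets_at_top UNIV)"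
    by (rule Weierstrass_m_test_general[OF _ sM]) (use M in auto)
  have c: "continuous_on {0..1} (\<lambda>x. \<Sum>n\<in>X. f n x)" for X
    by (intro continuous_on_sum cont)
  show "continuous_on {0..1} (\<lambda>x. \<Sum>\<^sub>\<infinity>n. f n x)"
    by (rule uniform_limit_theorem[OF _ u]) (auto intro: c)
  show "((\<lambda>n. integral {0..1} (f n)) has_sum integral {0..1} (\<lambda>x. \<Sum>\<^sub>\<infinity>n. f n x)) UNIV"
  proof (rule uniform_limit_integral[OF u c])
    fix I J assume IJ: "\<And>X. ((\<lambda>x. \<Sum>n\<in>X. f n x) has_integral I X) {0..1}"
      "((\<lambda>x. \<Sum>\<^sub>\<infinity>n. f n x) has_integral J) {0..1}" "(I \<longlongrightarrow> J) (finite_subsets_at_top UNIV)"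
    have "I X = (\<Sum>n\<in>X. integral {0..1} (f n))" if "finite X" for X
      using integral_unique[OF IJ(1)[of X]] that
      by (subst (asm) integral_sum) (auto intro: integrable_continuous_real cont)
    hence "eventually (\<lambda>X. I X = (\<Sum>n\<in>X. integral {0..1} (f n))) (finite_subsets_at_top UNIV)"
      by (intro eventually_finite_subsets_at_top_weakI) simp
    hence "((\<lambda>X. \<Sum>n\<in>X. integral {0..1} (f n)) \<longlongrightarrow> J) (finite_subsets_at_top UNIV)"
      using IJ(3) by (rule Lim_transform_eventually[rotated])
    thus ?thesis unfolding has_sum_def using integral_unique[OF IJ(2)] by simp
  qed auto
  show "x \<in> {0..1} \<Longrightarrow> ((\<lambda>n. f n x) has_sum (\<Sum>\<^sub>\<infinity>n. f n x)) UNIV"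
    by (rule has_sum_infsum, rule abs_summable_summable, rule summable_on_comparison_test[OF sM]) (use M in auto)
qed

text \<open>The translates of the unit interval tile the line. Half-open intervals are used because
  countable additivity wants disjoint pieces, and \<open>int_decode\<close> because it wants them
  indexed by natural numbers.\<close>

lemma unfold_integral_int:
  fixes \<phi> :: "real \<Rightarrow> real"
  assumes int: "integrable lborel \<phi>"
    and S: "((\<lambda>n::int. integral {0..1} (\<lambda>x. \<phi> (of_int n + x))) has_sum S) UNIV"
  shows "S = (LBINT x. \<phi> x)"
proof -
  define A where "A i = {real_of_int (int_decode i)..<real_of_int (int_decode i) + 1}" for i
  have meas: "A i \<in> sets lborel" for i by (simp add: A_def)
  have disj: "A i \<inter> A j = {}" if "i \<noteq> j" for i j
  proof -
    have "int_decode i \<noteq> int_decode j" using that by (metis int_decode_inverse)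
    thus ?thesis unfolding A_def by (auto simp: disjoint_iff)
  qed
  have UN: "(\<Union>i. A i) = UNIV"
  proof -
    have "x \<in> A (int_encode \<lfloor>x\<rfloor>)" for x by (simp add: A_def)
    hence "x \<in> (\<Union>i. A i)" for x by (rule UN_I[OF UNIV_I])
    thus ?thesis by (intro set_eqI iffI UNIV_I)
  qed
  have si: "set_integrable lborel X \<phi>" if "X \<in> sets borel" for X 
    using int that unfolding set_integrable_def by (intro integrable_mult_indicator) auto
  have piece: "(LBINT x:A i. \<phi> x) = integral {0..1} (\<lambda>x. \<phi> (of_int (int_decode i) + x))" for i
  proof -
    have "(LBINT x:A i. \<phi> x) = integral (A i) \<phi>"
      by (intro set_borel_integral_eq_integral si) (simp add: A_def)
    also have "\<dots> = integral {real_of_int (int_decode i)..real_of_int (int_decode i) + 1} \<phi>"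
      by (rule integral_spike_set; rule negligible_subset[of "{real_of_int (int_decode i) + 1}"]) (auto simp: A_def)
    also have "\<dots> = integral {0..1} (\<phi> \<circ> (+) (of_int (int_decode i)))"
      by (subst integral_shift_Icc_real) (simp add: add.commute)
    finally show ?thesis by (simp add: o_def)
  qed
  have "(\<lambda>i. integral {0..1} (\<lambda>x. \<phi> (of_int (int_decode i) + x))) sums S"
    by (rule has_sum_imp_sums,
        subst has_sum_reindex_bij_betw[OF bij_int_decode, of "\<lambda>n. integral {0..1} (\<lambda>x. \<phi> (of_int n + x))"],
        rule S)
  hence "S = (\<Sum>i. (LBINT x:A i. \<phi> x))" unfolding piece by (simp add: sums_iff)
  also have "\<dots> = (LBINT x:(\<Union>i. A i). \<phi> x)"
    by (rule lebesgue_integral_countable_add [symmetric]) (use meas disj UN si in simp_all)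
  also have "\<dots> = (LBINT x. \<phi> x)" by (simp add: UN set_lebesgue_integral_def)
  finally show ?thesis .
qed

lemma integral_cos_01: "integral {0..1} (\<lambda>x. cos (2 * pi * of_int m * x)) = (if m = 0 then 1 else 0)"
proof (cases "m = 0")
  case False
  have "((\<lambda>x. cos (2 * pi * of_int m * x)) has_integral
          (sin (2 * pi * of_int m * 1) / (2 * pi * of_int m) - sin (2 * pi * of_int m * 0) / (2 * pi * of_int m))) {0..1}"
    using False
    by (intro fundamental_theorem_of_calculus)
       (auto intro!: derivative_eq_intros simp: has_real_derivative_iff_has_vector_derivative [symmetric])
  moreover have "sin (2 * pi * of_int m) = 0" by (rule sin_int_2pin)
  ultimately show ?thesis using False by (simp add: integral_unique)
qed auto

lemma integral_sin_01: "integral {0..1} (\<lambda>x. sin (2 * pi * of_int m * x)) = 0"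
proof (cases "m = 0")
  case False
  have "((\<lambda>x. sin (2 * pi * of_int m * x)) has_integral
          ((- cos (2 * pi * of_int m * 1) / (2 * pi * of_int m)) - (- cos (2 * pi * of_int m * 0) / (2 * pi * of_int m)))) {0..1}"
    using False
    by (intro fundamental_theorem_of_calculus)
       (auto intro!: derivative_eq_intros simp: has_real_derivative_iff_has_vector_derivative [symmetric])
  moreover have "cos (2 * pi * of_int m) = 1" by (rule cos_int_2pin)
  ultimately show ?thesis using False by (simp add: integral_unique)
qed auto

lemma integral_cos_cos_01:
  "integral {0..1} (\<lambda>x. cos (2 * pi * of_int m * x) * cos (2 * pi * of_int k * x)) =
     ((if m = k then 1 else 0) + (if m = -k then 1 else 0)) / 2"
proof -
  have "(\<lambda>x. cos (2 * pi * of_int m * x) * cos (2 * pi * of_int k * x)) =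
      (\<lambda>x. (cos (2 * pi * of_int (m - k) * x) + cos (2 * pi * of_int (m + k) * x)) / 2)"
  proof
    fix x :: real
    have "2 * pi * of_int (m + k) * x = 2 * pi * of_int m * x + 2 * pi * of_int k * x"
         "2 * pi * of_int (m - k) * x = 2 * pi * of_int m * x - 2 * pi * of_int k * x"
      by (simp_all add: algebra_simps)
    thus "cos (2 * pi * of_int m * x) * cos (2 * pi * of_int k * x) =
      (cos (2 * pi * of_int (m - k) * x) + cos (2 * pi * of_int (m + k) * x)) / 2"
      by (simp only: cos_add cos_diff) simp
  qed
  moreover have "integral {0..1} (\<lambda>x. cos (2 * pi * of_int (m - k) * x) + cos (2 * pi * of_int (m + k) * x)) =
     (if m = k then 1 else 0) + (if m = -k then 1 else 0)"
    by (subst integral_add; (intro integrable_continuous_real continuous_intros)?)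
       (simp only: integral_cos_01, auto)
  ultimately show ?thesis by simp
qed

lemma integral_cos_sin_01:
  "integral {0..1} (\<lambda>x. cos (2 * pi * of_int m * x) * sin (2 * pi * of_int k * x)) = 0"
proof -
  have "(\<lambda>x. cos (2 * pi * of_int m * x) * sin (2 * pi * of_int k * x)) =
      (\<lambda>x. (sin (2 * pi * of_int (m + k) * x) - sin (2 * pi * of_int (m - k) * x)) / 2)"
  proof
    fix x :: real
    have "2 * pi * of_int (m + k) * x = 2 * pi * of_int m * x + 2 * pi * of_int k * x"
         "2 * pi * of_int (m - k) * x = 2 * pi * of_int m * x - 2 * pi * of_int k * x"
      by (simp_all add: algebra_simps)
    thus "cos (2 * pi * of_int m * x) * sin (2 * pi * of_int k * x) =
      (sin (2 * pi * of_int (m + k) * x) - sin (2 * pi * of_int (m - k) * x)) / 2"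
      by (simp only: sin_add sin_diff) simp
  qed
  moreover have "integral {0..1} (\<lambda>x. sin (2 * pi * of_int (m + k) * x) - sin (2 * pi * of_int (m - k) * x)) = 0"
    by (subst integral_diff; (intro integrable_continuous_real continuous_intros)?)
       (simp only: integral_sin_01 diff_self)
  ultimately show ?thesis by simp
qed

lemma gaussian_sin_integral:
  fixes t a :: real
  assumes t: "t > 0"
  shows "integrable lborel (\<lambda>x. exp (- pi * x ^ 2 / t) * sin (a * x))"
    and "(LBINT x. exp (- pi * x ^ 2 / t) * sin (a * x)) = 0"
proof -
  have "integrable lborel (\<lambda>x. exp (- pi * x ^ 2 / t))"
    using gaussian_cos_integral(1)[OF t, of 0] by simp
  thus "integrable lborel (\<lambda>x. exp (- pi * x ^ 2 / t) * sin (a * x))"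
    by (rule Bochner_Integration.integrable_bound)
       (auto intro!: AE_I2 mult_left_le simp: abs_mult abs_sin_le_one)
  have "(LBINT x. exp (- pi * x ^ 2 / t) * sin (a * x)) =
          \<bar>-1\<bar> *\<^sub>R (LBINT x. exp (- pi * (0 + (-1) * x) ^ 2 / t) * sin (a * (0 + (-1) * x)))"
    by (rule lborel_integral_real_affine) auto
  thus "(LBINT x. exp (- pi * x ^ 2 / t) * sin (a * x)) = 0" by simp
qed

text \<open>Both sides are continuous in x, agree at 0 and 1, and have the same Fourier
  coefficients. For the periodized Gaussian the trigonometric factor may be evaluated at n + x in
  place of x, so the coefficients unfold to integrals over the line; for the cosine series they come
  from orthogonality.\<close>

lemma poisson_gaussian:
  fixes t x :: real
  assumes t: "t > 0" and x: "x \<in> {0..1}"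
  shows "(\<lambda>n::int. exp (- pi * (of_int n + x) ^ 2 / t)) summable_on UNIV"
    and "((\<lambda>m::int. sqrt t * exp (- pi * of_int m ^ 2 * t) * cos (2 * pi * of_int m * x)) has_sum
           (\<Sum>\<^sub>\<infinity>n::int. exp (- pi * (of_int n + x) ^ 2 / t))) UNIV"
proof -
  define f where "f = (\<lambda>(n::int) x. exp (- pi * (of_int n + x) ^ 2 / t))"
  define g where "g = (\<lambda>(m::int) x. sqrt t * exp (- pi * of_int m ^ 2 * t) * cos (2 * pi * of_int m * x))"
  define Mf where "Mf = (\<lambda>n::int. exp (pi / t) * exp (- (pi / (2 * t)) * of_int n ^ 2))"
  define Mg where "Mg = (\<lambda>n::int. sqrt t * exp (- (pi * t) * of_int n ^ 2))"
  have sMf: "Mf summable_on UNIV" unfolding Mf_def using t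
    by (intro summable_on_cmult_right summable_on_gaussian_int) auto
  have sMg: "Mg summable_on UNIV" unfolding Mg_def using t
    by (intro summable_on_cmult_right summable_on_gaussian_int) auto
  have Mf: "\<bar>f n y\<bar> \<le> Mf n" if y: "y \<in> {0..1}" for n y
  proof -
    \<comment> \<open>Expanded, this is 2 (n + y)^2 >= n^2 - 2, the source of the majorant
      \<open>Mf\<close>, which does not depend on y.\<close>
    have "0 \<le> (2 * y + of_int n) ^ 2 + 2 * (1 - y ^ 2)"
      using y by (intro add_nonneg_nonneg) (auto simp: power_le_one)
    hence "of_int n ^ 2 - 2 \<le> 2 * (of_int n + y) ^ 2"
      by (simp add: power2_eq_square algebra_simps)
    hence "(pi / (2 * t)) * (of_int n ^ 2 - 2) \<le> (pi / (2 * t)) * (2 * (of_int n + y) ^ 2)"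
      using t by (intro mult_left_mono) auto
    moreover have "(pi / (2 * t)) * (of_int n ^ 2 - 2) = (pi / (2 * t)) * of_int n ^ 2 - pi / t"
      using t by (simp add: field_simps)
    moreover have "(pi / (2 * t)) * (2 * (of_int n + y) ^ 2) = pi * (of_int n + y) ^ 2 / t"
      using t by simp
    ultimately show ?thesis by (simp add: f_def Mf_def exp_add [symmetric])
  qed
  have Mg: "\<bar>g n y\<bar> \<le> Mg n" for n y
    using t by (simp add: g_def Mg_def abs_mult mult_ac mult_left_le)
  have cf: "continuous_on A (f n)" and cg: "continuous_on A (g n)" for A n
    using t by (auto simp: f_def g_def intro!: continuous_intros)
  note F = series_integral_01[OF cf Mf sMf]
  note G = series_integral_01[OF cg Mg sMg]
  have coeff: "((\<lambda>n. integral {0..1} (\<lambda>x. h n x * w x)) has_sum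
                 integral {0..1} (\<lambda>x. (\<Sum>\<^sub>\<infinity>n. h n x) * w x)) UNIV"
    if h: "\<And>n. continuous_on {0..1} (h n)" "\<And>n y. y \<in> {0..1} \<Longrightarrow> \<bar>h n y\<bar> \<le> M n" "M summable_on UNIV"
      and w: "continuous_on {0..1} w" "\<And>x. \<bar>w x\<bar> \<le> 1" for h :: "int \<Rightarrow> real \<Rightarrow> real" and w and M :: "int \<Rightarrow> real"
  proof -
    have b: "\<bar>h n y * w y\<bar> \<le> M n" if "y \<in> {0..1}" for n y
      using mult_mono[OF h(2)[OF that, of n] w(2)[of y]] h(2)[OF that, of n] by (simp add: abs_mult)
    have "((\<lambda>n. integral {0..1} (\<lambda>x. h n x * w x)) has_sum
                 integral {0..1} (\<lambda>x. \<Sum>\<^sub>\<infinity>n. h n x * w x)) UNIV"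
      by (rule series_integral_01(2)[where M = M]) (auto intro!: continuous_intros h w b)
    also have "integral {0..1} (\<lambda>x. \<Sum>\<^sub>\<infinity>n. h n x * w x) = integral {0..1} (\<lambda>x. (\<Sum>\<^sub>\<infinity>n. h n x) * w x)"
      by (simp add: infsum_cmult_left')
    finally show ?thesis .
  qed
  define P where "P = (\<lambda>x. \<Sum>\<^sub>\<infinity>n. f n x)"
  define R where "R = (\<lambda>x. \<Sum>\<^sub>\<infinity>n. g n x)"
  have P_cos: "integral {0..1} (\<lambda>x. P x * cos (2 * pi * of_int k * x)) = sqrt t * exp (- pi * of_int k ^ 2 * t)" for k :: int
  proof -
    have per: "f n x * cos (2 * pi * of_int k * x) = 
       exp (- pi * (of_int n + x) ^ 2 / t) * cos (2 * pi * of_int k * (of_int n + x))" for n x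
    proof -
      have "cos (2 * pi * of_int k * x) = cos (2 * pi * of_int k * x + 2 * pi * of_int (k * n))"
        by (simp only: cos_add cos_int_2pin sin_int_2pin)
      also have "2 * pi * of_int k * x + 2 * pi * of_int (k * n) = 2 * pi * of_int k * (of_int n + x)"
        by (simp add: algebra_simps)
      finally show ?thesis by (simp add: f_def)
    qed
    have "((\<lambda>n. integral {0..1} (\<lambda>x. f n x * cos (2 * pi * of_int k * x))) has_sum
            integral {0..1} (\<lambda>x. P x * cos (2 * pi * of_int k * x))) UNIV"
      unfolding P_def by (rule coeff[OF cf Mf sMf]) (auto intro!: continuous_intros)
    hence "integral {0..1} (\<lambda>x. P x * cos (2 * pi * of_int k * x)) = 
             (LBINT x. exp (- pi * x ^ 2 / t) * cos (2 * pi * of_int k * x))"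
      unfolding per by (rule unfold_integral_int[OF gaussian_cos_integral(1)[OF t]])
    also have "\<dots> = sqrt t * exp (- pi * of_int k ^ 2 * t)"
      unfolding gaussian_cos_integral(2)[OF t] by (simp add: power2_eq_square)
    finally show ?thesis .
  qed
  have P_sin: "integral {0..1} (\<lambda>x. P x * sin (2 * pi * of_int k * x)) = 0" for k :: int
  proof -
    have per: "f n x * sin (2 * pi * of_int k * x) = 
       exp (- pi * (of_int n + x) ^ 2 / t) * sin (2 * pi * of_int k * (of_int n + x))" for n x
    proof -
      have "sin (2 * pi * of_int k * x) = sin (2 * pi * of_int k * x + 2 * pi * of_int (k * n))"
        by (simp only: sin_add cos_int_2pin sin_int_2pin)
      also have "2 * pi * of_int k * x + 2 * pi * of_int (k * n) = 2 * pi * of_int k * (of_int n + x)"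
        by (simp add: algebra_simps)
      finally show ?thesis by (simp add: f_def)
    qed
    have "((\<lambda>n. integral {0..1} (\<lambda>x. f n x * sin (2 * pi * of_int k * x))) has_sum
            integral {0..1} (\<lambda>x. P x * sin (2 * pi * of_int k * x))) UNIV"
      unfolding P_def by (rule coeff[OF cf Mf sMf]) (auto intro!: continuous_intros)
    hence "integral {0..1} (\<lambda>x. P x * sin (2 * pi * of_int k * x)) = 
             (LBINT x. exp (- pi * x ^ 2 / t) * sin (2 * pi * of_int k * x))"
      unfolding per by (rule unfold_integral_int[OF gaussian_sin_integral(1)[OF t]])
    thus ?thesis unfolding gaussian_sin_integral(2)[OF t] .
  qed
  have R_cos: "integral {0..1} (\<lambda>x. R x * cos (2 * pi * of_int k * x)) = sqrt t * exp (- pi * of_int k ^ 2 * t)" for k :: int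
  proof -
    define c where "c = (\<lambda>m::int. sqrt t * exp (- pi * of_int m ^ 2 * t))"
    have A: "((\<lambda>n. integral {0..1} (\<lambda>x. g n x * cos (2 * pi * of_int k * x))) has_sum
            integral {0..1} (\<lambda>x. R x * cos (2 * pi * of_int k * x))) UNIV"
      unfolding R_def by (rule coeff[OF cg Mg sMg]) (auto intro!: continuous_intros)
    \<comment> \<open>Only n = k and n = -k survive. The two halves are kept as separate terms, so
      that for k = 0 they add up to c 0 without a case distinction.\<close>
    have B: "(\<lambda>n. integral {0..1} (\<lambda>x. g n x * cos (2 * pi * of_int k * x))) =
        (\<lambda>n. (if n = k then c n / 2 else 0) + (if n = -k then c n / 2 else 0))"
    proof
      fix n
      have "integral {0..1} (\<lambda>x. g n x * cos (2 * pi * of_int k * x)) =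
            integral {0..1} (\<lambda>x. c n * (cos (2 * pi * of_int n * x) * cos (2 * pi * of_int k * x)))"
        by (simp add: g_def c_def mult.assoc)
      also have "\<dots> = (if n = k then c n / 2 else 0) + (if n = -k then c n / 2 else 0)"
        by (subst integral_mult_right, subst integral_cos_cos_01) (auto simp: field_simps)
      finally show "integral {0..1} (\<lambda>x. g n x * cos (2 * pi * of_int k * x)) = \<dots>" .
    qed
    have C: "((\<lambda>n. (if n = k then c n / 2 else 0) + (if n = -k then c n / 2 else 0)) has_sum (c k / 2 + c (-k) / 2)) UNIV"
    proof (rule has_sum_add)
      show "((\<lambda>n. if n = k then c n / 2 else 0) has_sum c k / 2) UNIV"
        by (rule has_sum_finite_neutralI[where B = "{k}"]) auto
      show "((\<lambda>n. if n = -k then c n / 2 else 0) has_sum c (-k) / 2) UNIV"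
        by (rule has_sum_finite_neutralI[where B = "{-k}"]) auto
    qed
    have "integral {0..1} (\<lambda>x. R x * cos (2 * pi * of_int k * x)) = c k / 2 + c (-k) / 2"
      by (rule has_sum_unique[OF A[unfolded B] C])
    thus ?thesis by (simp add: c_def)
  qed
  have R_sin: "integral {0..1} (\<lambda>x. R x * sin (2 * pi * of_int k * x)) = 0" for k :: int
  proof -
    have "((\<lambda>n. integral {0..1} (\<lambda>x. g n x * sin (2 * pi * of_int k * x))) has_sum
            integral {0..1} (\<lambda>x. R x * sin (2 * pi * of_int k * x))) UNIV"
      unfolding R_def by (rule coeff[OF cg Mg sMg]) (auto intro!: continuous_intros)
    moreover have "integral {0..1} (\<lambda>x. g n x * sin (2 * pi * of_int k * x)) = 0" for n
      unfolding g_def mult.assoc[of "sqrt t * _"] by (subst integral_mult_right, subst integral_cos_sin_01) simp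
    ultimately have "((\<lambda>_::int. 0) has_sum integral {0..1} (\<lambda>x. R x * sin (2 * pi * of_int k * x))) UNIV"
      by (simp only:)
    thus ?thesis by (rule has_sum_unique) (auto intro: has_sum_0)
  qed
  have cP: "continuous_on {0..1} P" and cR: "continuous_on {0..1} R"
    unfolding P_def R_def by (rule F(1), assumption) (rule G(1))
  have i: "(\<lambda>x. P x * cos (2 * pi * of_int m * x)) integrable_on {0..1}"
          "(\<lambda>x. R x * cos (2 * pi * of_int m * x)) integrable_on {0..1}"
          "(\<lambda>x. P x * sin (2 * pi * of_int m * x)) integrable_on {0..1}"
          "(\<lambda>x. R x * sin (2 * pi * of_int m * x)) integrable_on {0..1}" for m :: int
    by (intro integrable_continuous_real continuous_intros cP cR)+
  have "P x - R x = 0"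
  proof (rule fourier_coeffs_zero_imp_zero[OF _ _ _ _ x])
    show "continuous_on {0..1} (\<lambda>x. P x - R x)" by (intro continuous_intros cP cR)
    have "P 1 = (\<Sum>\<^sub>\<infinity>n. f (n + 1) 0)" by (simp add: P_def f_def)
    also have "\<dots> = P 0" unfolding P_def
      by (rule infsum_reindex_bij_witness[where i = "\<lambda>n. n - 1" and j = "\<lambda>n. n + 1"]) auto
    finally have "P 1 = P 0" .
    moreover have "R 1 = R 0" by (simp add: R_def g_def cos_int_2pin)
    ultimately show "P 0 - R 0 = P 1 - R 1" by simp
    show "integral {0..1} (\<lambda>x. (P x - R x) * cos (2 * pi * of_int m * x)) = 0"
         "integral {0..1} (\<lambda>x. (P x - R x) * sin (2 * pi * of_int m * x)) = 0" for m :: int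
      by (simp_all only: left_diff_distrib integral_diff i P_cos P_sin R_cos R_sin diff_self)
  qed
  moreover have "((\<lambda>m. g m x) has_sum R x) UNIV" unfolding R_def using G(3)[of x] x by simp
  ultimately show "((\<lambda>m::int. sqrt t * exp (- pi * of_int m ^ 2 * t) * cos (2 * pi * of_int m * x)) has_sum
           (\<Sum>\<^sub>\<infinity>n::int. exp (- pi * (of_int n + x) ^ 2 / t))) UNIV"
    by (simp add: g_def P_def f_def)
  have "((\<lambda>n. f n x) has_sum P x) UNIV" unfolding P_def using F(3)[of x] x by simp
  thus "(\<lambda>n::int. exp (- pi * (of_int n + x) ^ 2 / t)) summable_on UNIV"
    unfolding f_def by (rule has_sum_imp_summable)
qed

section \<open>Euler's pentagonal series and Dedekind's eta function\<close>

definition pent :: "int \<Rightarrow> int" where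
  "pent n = n * (3 * n - 1) div 2"

lemma two_pent: "2 * pent n = n * (3 * n - 1)"
  unfolding pent_def by (rule dvd_mult_div_cancel) auto

lemma pent_nonneg: "pent n \<ge> 0"
proof -
  have "n * (3 * n - 1) \<ge> 0" by (cases "n \<ge> 1") (auto simp: zero_le_mult_iff)
  thus ?thesis using two_pent[of n] by linarith
qed

lemma inj_pent: "inj pent"
proof (rule injI)
  fix m n assume "pent m = pent n"
  hence "m * (3 * m - 1) = n * (3 * n - 1)" using two_pent by metis
  hence "(m - n) * (3 * (m + n) - 1) = 0" by (simp add: algebra_simps)
  moreover have "3 * (m + n) - 1 \<noteq> 0" by presburger
  ultimately show "m = n" by auto
qed

lemma inj_nat_pent: "inj (\<lambda>n. nat (pent n))"
proof (rule injI)
  fix m n assume "nat (pent m) = nat (pent n)"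
  hence "pent m = pent n" using pent_nonneg[of m] pent_nonneg[of n] by simp
  thus "m = n" by (rule injD[OF inj_pent])
qed

lemma minus_one_powi: "(-1 :: complex) powi n = (if even n then 1 else -1)"
  by (simp add: power_int_minus_left)

text \<open>This turns the two-sided series into a power series with coefficients 0, 1 and -1. The
  value of \<open>inv\<close> is determined because each exponent arises from at most one n.\<close>

definition pent_coeff :: "nat \<Rightarrow> complex" where
  "pent_coeff m = (if m \<in> range (\<lambda>n. nat (pent n)) then (-1) powi (inv (\<lambda>n. nat (pent n)) m) else 0)"

lemma pent_coeff_pent: "pent_coeff (nat (pent n)) = (-1) powi n"
  using inv_f_f[OF inj_nat_pent, of n] by (simp add: pent_coeff_def)

lemma pent_coeff_eq_0: "(\<And>n. nat (pent n) \<noteq> m) \<Longrightarrow> pent_coeff m = 0"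
  by (auto simp: pent_coeff_def)

lemma norm_pent_coeff: "norm (pent_coeff m) \<le> 1"
  by (simp add: pent_coeff_def minus_one_powi)

lemma abs_summable_pent_series:
  assumes "norm q < 1"
  shows "summable (\<lambda>m. norm (pent_coeff (m + k) * q ^ m))"
proof (rule summable_comparison_test)
  show "summable (\<lambda>m. norm q ^ m)" using assms by (simp add: summable_geometric)
  show "\<exists>N. \<forall>m\<ge>N. norm (norm (pent_coeff (m + k) * q ^ m)) \<le> norm q ^ m"
    by (simp add: norm_mult norm_power mult_left_le_one_le norm_pent_coeff)
qed

lemma has_sum_ram_f:
  assumes "norm q < 1"
  shows "((\<lambda>n::int. (-1) powi n * q powi pent n) has_sum ram_f q) UNIV"
    and "(\<lambda>m. pent_coeff m * q ^ m) sums ram_f q"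
proof -
  have "summable (\<lambda>m. norm (pent_coeff m * q ^ m))"
    using abs_summable_pent_series[OF assms, of 0] by simp
  hence "(\<lambda>m. pent_coeff m * q ^ m) summable_on UNIV"
    by (rule norm_summable_imp_summable_on)
  then obtain S where S: "((\<lambda>m. pent_coeff m * q ^ m) has_sum S) UNIV"
    by (auto simp: summable_on_def)
  also have "?this \<longleftrightarrow> ((\<lambda>m. pent_coeff m * q ^ m) has_sum S) (range (\<lambda>n. nat (pent n)))"
    by (rule has_sum_cong_neutral) (auto intro!: pent_coeff_eq_0)
  also have "\<dots> \<longleftrightarrow> ((\<lambda>n::int. (-1) powi n * q powi pent n) has_sum S) UNIV"
    by (subst has_sum_reindex[OF inj_nat_pent])
       (simp add: o_def pent_coeff_pent power_int_def pent_nonneg)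
  finally have S': "((\<lambda>n::int. (-1) powi n * q powi pent n) has_sum S) UNIV" .
  hence "ram_f q = S" unfolding ram_f_def pent_def by (rule infsumI)
  with S S' show "((\<lambda>n::int. (-1) powi n * q powi pent n) has_sum ram_f q) UNIV"
    "(\<lambda>m. pent_coeff m * q ^ m) sums ram_f q" by (auto intro: has_sum_imp_sums)
qed

lemma holomorphic_ram_f: "ram_f holomorphic_on ball 0 1"
  by (rule power_series_holomorphic[of 0 1 pent_coeff])
     (auto intro!: has_sum_ram_f)

lemma pent_bound:
  assumes "pent n < 13"
  shows "n \<in> {-2, -1, 0, 1, 2, 3}"
proof -
  have *: "n * (3 * n - 1) < 26" using assms two_pent[of n] by linarith
  have "n < 4"
  proof (rule ccontr)
    assume "\<not> n < 4"
    hence "4 * 11 \<le> n * (3 * n - 1)" by (intro mult_mono) auto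
    thus False using * by simp
  qed
  moreover have "n > -3"
  proof (rule ccontr)
    assume "\<not> n > -3"
    hence "3 * 10 \<le> (-n) * (1 - 3 * n)" by (intro mult_mono) auto
    thus False using * by (simp add: algebra_simps)
  qed
  ultimately show ?thesis by auto
qed

lemma pent_coeff_small:
  "pent_coeff 0 = 1" "pent_coeff (Suc 0) = -1" "pent_coeff 2 = -1" "pent_coeff 3 = 0" "pent_coeff 4 = 0"
  "pent_coeff 5 = 1" "pent_coeff 6 = 0" "pent_coeff 7 = 1" "pent_coeff 8 = 0" "pent_coeff 9 = 0"
  "pent_coeff 10 = 0" "pent_coeff 11 = 0" "pent_coeff 12 = -1"
proof -
  have z: "pent_coeff m = 0" if "m < 13" "m \<notin> {0, 1, 2, 5, 7, 12}" for m
  proof (rule pent_coeff_eq_0)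
    fix n show "nat (pent n) \<noteq> m"
    proof
      assume m: "nat (pent n) = m"
      hence p: "pent n = int m" using pent_nonneg[of n] by auto
      hence "n \<in> {-2, -1, 0, 1, 2, 3}" using that(1) by (intro pent_bound) auto
      thus False using m that(2) by (auto simp: pent_def)
    qed
  qed
  show "pent_coeff 3 = 0" "pent_coeff 4 = 0" "pent_coeff 6 = 0" "pent_coeff 8 = 0" 
       "pent_coeff 9 = 0" "pent_coeff 10 = 0" "pent_coeff 11 = 0" by (rule z; simp)+
  show "pent_coeff 0 = 1" "pent_coeff (Suc 0) = -1" "pent_coeff 2 = -1"
    "pent_coeff 5 = 1" "pent_coeff 7 = 1" "pent_coeff 12 = -1"
    using pent_coeff_pent[of 0] pent_coeff_pent[of 1] pent_coeff_pent[of "-1"] 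
      pent_coeff_pent[of 2] pent_coeff_pent[of "-2"] pent_coeff_pent[of 3]
    by (simp_all add: pent_def minus_one_powi)
qed

text \<open>The remainder is recorded with a holomorphic cofactor and not as an order estimate,
  since in the end a quotient by q^13 has to be holomorphic for the maximum principle.\<close>

lemma ram_f_expansion:
  obtains h where "h holomorphic_on ball 0 1"
    "\<And>q. norm q < 1 \<Longrightarrow> ram_f q = 1 - q - q^2 + q^5 + q^7 - q^12 + q^13 * h q"
proof
  define h where "h = (\<lambda>q. \<Sum>m. pent_coeff (m + 13) * q ^ m)"
  have sm: "summable (\<lambda>m. pent_coeff (m + 13) * q ^ m)" if "norm q < 1" for q
    using summable_norm_cancel[OF abs_summable_pent_series[OF that]] .
  show "h holomorphic_on ball 0 1"
    by (rule power_series_holomorphic[of 0 1 "\<lambda>m. pent_coeff (m + 13)"])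
       (use sm in \<open>auto simp: h_def intro!: summable_sums\<close>)
  fix q :: complex assume q: "norm q < 1"
  have "ram_f q = (\<Sum>m. pent_coeff m * q ^ m)" using has_sum_ram_f(2)[OF q] by (simp add: sums_iff)
  also have "\<dots> = (\<Sum>m. pent_coeff (m + 13) * q ^ (m + 13)) + (\<Sum>m<13. pent_coeff m * q ^ m)"
    using has_sum_ram_f(2)[OF q] by (intro suminf_split_initial_segment) (simp add: sums_iff)
  also have "(\<Sum>m. pent_coeff (m + 13) * q ^ (m + 13)) = q ^ 13 * h q"
    unfolding h_def using suminf_mult[OF sm[OF q], of "q^13"] by (simp add: power_add mult_ac)
  also have "(\<Sum>m<13. pent_coeff m * q ^ m) = 1 - q - q^2 + q^5 + q^7 - q^12"
    by (simp add: lessThan_nat_numeral lessThan_Suc pent_coeff_small)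
  finally show "ram_f q = 1 - q - q^2 + q^5 + q^7 - q^12 + q^13 * h q" by (simp add: algebra_simps)
qed

section \<open>Dedekind's eta function and its inversion formula\<close>

definition eta :: "complex \<Rightarrow> complex" where
  "eta \<tau> = exp (pi * \<i> * \<tau> / 12) * ram_f (exp (2 * pi * \<i> * \<tau>))"

lemma norm_nome: "norm (exp (2 * pi * \<i> * \<tau>)) = exp (- 2 * pi * Im \<tau>)"
  by simp

lemma norm_nome_less: "Im \<tau> > 0 \<Longrightarrow> norm (exp (2 * pi * \<i> * \<tau>)) < 1"
  by simp

lemma holomorphic_eta: "eta holomorphic_on {\<tau>. Im \<tau> > 0}"
proof -
  have "(\<lambda>\<tau>. ram_f (exp (2 * pi * \<i> * \<tau>))) holomorphic_on {\<tau>. Im \<tau> > 0}"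
    by (rule holomorphic_on_compose_gen[OF _ holomorphic_ram_f, unfolded o_def])
       (auto intro!: holomorphic_intros)
  thus ?thesis unfolding eta_def[abs_def] by (intro holomorphic_intros) auto
qed

text \<open>Completing the square: n (3n - 1) + 1/12 = (6n - 1)^2 / 12. The prefactor of
  \<open>eta\<close> supplies exactly the missing 1/12.\<close>

lemma has_sum_eta_imag:
  assumes y: "y > 0"
  shows "((\<lambda>n::int. (-1) powi n * of_real (exp (- pi * (6 * of_int n - 1) ^ 2 * y / 12))) has_sum eta (\<i> * of_real y)) UNIV"
proof -
  define q where "q = exp (2 * pi * \<i> * (\<i> * of_real y))"
  have "2 * pi * \<i> * (\<i> * of_real y) = of_real (- 2 * pi * y)" by (simp add: complex_eq_iff)
  hence q: "q = exp (of_real (- 2 * pi * y))" by (simp only: q_def)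
  have "norm q < 1" using y unfolding q_def by (intro norm_nome_less) auto
  hence "((\<lambda>n::int. exp (pi * \<i> * (\<i> * of_real y) / 12) * ((-1) powi n * q powi pent n)) has_sum eta (\<i> * of_real y)) UNIV"
    unfolding eta_def by (fold q_def) (intro has_sum_cmult_right has_sum_ram_f)
  moreover have "exp (pi * \<i> * (\<i> * of_real y) / 12) * ((-1) powi n * q powi pent n) =
      (-1) powi n * of_real (exp (- pi * (6 * of_int n - 1) ^ 2 * y / 12))" for n
  proof -
    have "q powi pent n = exp (of_int (pent n) * of_real (- 2 * pi * y))"
      unfolding q by (rule exp_power_int)
    also have "exp (pi * \<i> * (\<i> * of_real y) / 12) * \<dots> = of_real (exp (- pi * y / 12 + of_int (pent n) * (- 2 * pi * y)))"
      by (simp only: exp_add [symmetric] exp_of_real [symmetric], rule arg_cong[where f = exp])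
         (simp add: complex_eq_iff)
    also have "- pi * y / 12 + of_int (pent n) * (- 2 * pi * y) = - pi * y / 12 - pi * y * of_int (2 * pent n)"
      by simp
    also have "\<dots> = - pi * (6 * of_int n - 1) ^ 2 * y / 12"
      unfolding two_pent by (simp add: field_simps power2_eq_square)
    finally show ?thesis by (simp add: mult_ac)
  qed
  ultimately show ?thesis by simp
qed

lemma cos_diff_sixth:
  "cos (2 * pi * of_int (6 * n - 1) * (1/12)) - cos (2 * pi * of_int (6 * n - 1) * (5/12)) =
     sqrt 3 * (if even n then 1 else -1)"
proof -
  have s: "sin (pi * of_int n) = 0" "sin (pi * of_int (5 * n)) = 0"
    using sin_npi_int[of n] sin_npi_int[of "5 * n"] by (simp_all add: mult_ac)
  have c: "cos (pi * of_int n) = (if even n then 1 else -1)"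
          "cos (pi * of_int (5 * n)) = (if even n then 1 else -1)"
    using cos_npi_int[of n] cos_npi_int[of "5 * n"] by (simp_all add: mult_ac)
  have "2 * pi * of_int (6 * n - 1) * (1/12) = pi * of_int n - pi / 6"
       "2 * pi * of_int (6 * n - 1) * (5/12) = pi * of_int (5 * n) - (pi - pi / 6)"
    by (simp_all add: field_simps)
  thus ?thesis by (simp only: cos_diff s c) (simp add: cos_30 cos_diff)
qed

lemma cos_diff_nonunit:
  assumes "m mod 6 \<noteq> 1" "m mod 6 \<noteq> (5::int)"
  shows "cos (2 * pi * of_int m * (1/12)) - cos (2 * pi * of_int m * (5/12)) = 0"
proof -
  have "cos (2 * pi * of_int m * (1/12)) - cos (2 * pi * of_int m * (5/12)) = 
          2 * sin (pi * of_int m / 2) * sin (pi * of_int m / 3)"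
    by (subst cos_diff_cos) (simp add: field_simps)
  moreover have "even m \<or> 3 dvd m" using assms by presburger
  moreover have "sin (pi * of_int (2 * k) / 2) = 0" "sin (pi * of_int (3 * k) / 3) = 0" for k :: int
    using sin_npi_int[of k] by (simp_all add: mult_ac)
  ultimately show ?thesis by (auto elim!: dvdE)
qed

text \<open>The character $\chi(m) = (12/m)$ equals $(\cos(\pi m/6) - \cos(5\pi m/6))/\sqrt 3$, so that the eta series
  is a difference of two values of the theta series in Poisson's formula.\<close>

lemma eta_inversion_imag:
  assumes y: "y > 0"
  shows "eta (\<i> / of_real y) = of_real (sqrt y) * eta (\<i> * of_real y)"
proof -
  define sg :: "int \<Rightarrow> real" where "sg = (\<lambda>n. if even n then 1 else -1)"
  define G where "G = (\<lambda>v n. sg n * exp (- pi * (6 * of_int n - 1) ^ 2 * v / 12))"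
  have hG: "((\<lambda>n. complex_of_real (G v n)) has_sum eta (\<i> * of_real v)) UNIV" if "v > 0" for v
  proof -
    have "(\<lambda>n. complex_of_real (G v n)) =
            (\<lambda>n. (-1) powi n * of_real (exp (- pi * (6 * of_int n - 1) ^ 2 * v / 12)))"
      by (auto simp: G_def sg_def minus_one_powi)
    thus ?thesis using has_sum_eta_imag[OF that] by simp
  qed
  define E where "E = (\<lambda>v. Re (eta (\<i> * of_real v)))"
  have hE: "(G v has_sum E v) UNIV" if "v > 0" for v
    using has_sum_Re[OF hG[OF that]] by (simp add: E_def)
  have eta_E: "eta (\<i> * of_real v) = of_real (E v)" if "v > 0" for v
    using has_sum_unique[OF hG[OF that] has_sum_of_real[OF hE[OF that]]] .
  \<comment> \<open>With this t the Gaussians at the offsets 1/12 and 5/12 have exponents -pi (12 l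
    + 1)^2 / (12 y) and -pi (12 l + 5)^2 / (12 y). Up to sign, 12 l + 1 and 12 l + 5 are the values
    of 6n - 1 at n = -2l and n = 2l + 1, where the eta series has sign + and -.\<close>
  define t where "t = y / 12"
  have t: "t > 0" using y by (simp add: t_def)
  define A where "A = (\<lambda>x. \<Sum>\<^sub>\<infinity>n::int. exp (- pi * (of_int n + x) ^ 2 / t))"
  define c where "c = (\<lambda>m::int. sqrt t * exp (- pi * of_int m ^ 2 * t))"
  define T where "T = (\<lambda>m::int. c m * (cos (2 * pi * of_int m * (1/12)) - cos (2 * pi * of_int m * (5/12))))"
  have hA: "((\<lambda>n::int. exp (- pi * (of_int n + x) ^ 2 / t)) has_sum A x) UNIV" if "x \<in> {0..1}" for x
    unfolding A_def by (intro has_sum_infsum poisson_gaussian(1) t that)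

  have "E (1/y) = A (1/12) - A (5/12)"
  proof (rule has_sum_unique[OF hE])
    show "0 < 1 / y" using y by simp
    define S1 where "S1 = range (\<lambda>l::int. - 2 * l)"
    define S2 where "S2 = range (\<lambda>l::int. 2 * l + 1)"
    have e1: "G (1/y) (- 2 * l) = exp (- pi * (of_int l + 1/12) ^ 2 / t)" for l
      using y by (simp add: G_def sg_def t_def field_simps power2_eq_square)
    have e2: "G (1/y) (2 * l + 1) = - exp (- pi * (of_int l + 5/12) ^ 2 / t)" for l
      using y by (simp add: G_def sg_def t_def field_simps power2_eq_square)
    have "(G (1/y) has_sum A (1/12)) S1" unfolding S1_def
      by (subst has_sum_reindex) (use hA[of "1/12"] in \<open>auto simp: inj_on_def o_def e1[simplified]\<close>)
    moreover have "(G (1/y) has_sum (- A (5/12))) S2" unfolding S2_def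
      by (subst has_sum_reindex) (use hA[of "5/12"] in \<open>auto simp: inj_on_def o_def e2[simplified] has_sum_uminus\<close>)
    moreover have "S1 \<inter> S2 = {}" unfolding S1_def S2_def by (auto, presburger)
    ultimately have "(G (1/y) has_sum (A (1/12) + - A (5/12))) (S1 \<union> S2)"
      by (rule has_sum_Un_disjoint)
    also have "S1 \<union> S2 = UNIV"
    proof -
      have "n \<in> S1 \<union> S2" for n
      proof (cases "even n")
        case True
        hence "n = - 2 * (- (n div 2))" by simp
        thus ?thesis unfolding S1_def by blast
      next
        case False
        hence "n = 2 * (n div 2) + 1" by simp
        thus ?thesis unfolding S2_def by blast
      qed
      thus ?thesis by auto
    qed
    finally show "(G (1/y) has_sum (A (1/12) - A (5/12))) UNIV" by simp
  qed
  moreover have "A (1/12) - A (5/12) = sqrt y * E y"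
  proof (rule has_sum_unique[where f = T and A = UNIV])
    have hc: "((\<lambda>m. c m * cos (2 * pi * of_int m * x)) has_sum A x) UNIV" if "x \<in> {0..1}" for x
      using poisson_gaussian(2)[OF t that] by (simp add: c_def A_def)
    have h1: "((\<lambda>m. c m * cos (2 * pi * of_int m * (1/12))) has_sum A (1/12)) UNIV"
      by (rule hc) simp
    have h5: "((\<lambda>m. - (c m * cos (2 * pi * of_int m * (5/12)))) has_sum - A (5/12)) UNIV"
      unfolding has_sum_uminus minus_minus by (rule hc) simp
    show "(T has_sum (A (1/12) - A (5/12))) UNIV"
      using has_sum_add[OF h1 h5] unfolding T_def right_diff_distrib by (simp only: diff_conv_add_uminus)
    \<comment> \<open>The terms with m congruent to -1 and to 1 modulo 6 each give half of the
      result, since \<open>T\<close> is even; all other terms vanish.\<close>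
    define S1 where "S1 = range (\<lambda>n::int. 6 * n - 1)"
    define S2 where "S2 = range (\<lambda>n::int. 1 - 6 * n)"
    have T1: "T (6 * n - 1) = (sqrt y / 2) * G y n" for n
    proof -
      have "T (6 * n - 1) = c (6 * n - 1) * (sqrt 3 * sg n)"
        unfolding T_def cos_diff_sixth sg_def ..
      also have "\<dots> = (sqrt t * sqrt 3) * (sg n * exp (- pi * of_int (6 * n - 1) ^ 2 * t))"
        by (simp add: c_def)
      also have "sqrt t * sqrt 3 = sqrt (y / 4)" by (simp add: t_def real_sqrt_mult [symmetric])
      also have "\<dots> = sqrt y / 2" by (simp add: real_sqrt_divide)
      finally show ?thesis by (simp add: G_def t_def)
    qed
    have Tm: "T (- m) = T m" for m by (simp add: T_def c_def)
    have T2: "T (1 - 6 * n) = (sqrt y / 2) * G y n" for n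
      using T1[of n] Tm[of "6 * n - 1"] by simp
    have "(T has_sum (sqrt y / 2 * E y)) S1" unfolding S1_def
      by (subst has_sum_reindex) (use has_sum_cmult_right[OF hE[OF y], of "sqrt y / 2"] in \<open>auto simp: inj_on_def o_def T1\<close>)
    moreover have "(T has_sum (sqrt y / 2 * E y)) S2" unfolding S2_def
      by (subst has_sum_reindex) (use has_sum_cmult_right[OF hE[OF y], of "sqrt y / 2"] in \<open>auto simp: inj_on_def o_def T2\<close>)
    moreover have "S1 \<inter> S2 = {}" unfolding S1_def S2_def by (auto, presburger)
    ultimately have "(T has_sum (sqrt y / 2 * E y + sqrt y / 2 * E y)) (S1 \<union> S2)"
      by (rule has_sum_Un_disjoint)
    also have "?this \<longleftrightarrow> (T has_sum (sqrt y / 2 * E y + sqrt y / 2 * E y)) UNIV"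
    proof (rule has_sum_cong_neutral)
      fix m assume m: "m \<in> UNIV - (S1 \<union> S2)"
      have "m \<in> S1" if "m mod 6 = 5"
      proof -
        have "m = 6 * (m div 6 + 1) - 1" using that by presburger
        thus ?thesis unfolding S1_def by blast
      qed
      moreover have "m \<in> S2" if "m mod 6 = 1"
      proof -
        have "m = 1 - 6 * (- (m div 6))" using that by presburger
        thus ?thesis unfolding S2_def by blast
      qed
      ultimately show "T m = 0" unfolding T_def using m by (subst cos_diff_nonunit) auto
    qed auto
    finally show "(T has_sum (sqrt y * E y)) UNIV" by (simp add: mult.commute)
  qed
  ultimately have "E (1/y) = sqrt y * E y" by simp
  moreover have "\<i> / of_real y = \<i> * of_real (1 / y)" by (simp add: divide_inverse)
  ultimately show ?thesis using eta_E[OF y] eta_E[of "1/y"] y by simp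
qed

theorem eta_inversion:
  assumes "Im \<tau> > 0"
  shows "eta (- 1 / \<tau>) = csqrt (- \<i> * \<tau>) * eta \<tau>"
proof -
  define H where "H = {\<tau>::complex. Im \<tau> > 0}"
  have Im_inv: "Im (- 1 / z) > 0" if "z \<in> H" for z
  proof -
    have "z \<noteq> 0" using that by (auto simp: H_def)
    hence "(Re z)\<^sup>2 + (Im z)\<^sup>2 > 0" by (rule complex_neq_0[THEN iffD1])
    thus ?thesis using that by (simp add: H_def Im_divide)
  qed
  have nz: "0 \<notin> H" by (simp add: H_def)
  define U where "U = (\<lambda>y. \<i> * complex_of_real y) ` {0<..}"
  have "eta (- 1 / \<tau>) - csqrt (- \<i> * \<tau>) * eta \<tau> = 0"
  proof (rule analytic_continuation[where S = H and U = U and \<xi> = \<i> and w = \<tau> and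
        f = "\<lambda>\<tau>. eta (- 1 / \<tau>) - csqrt (- \<i> * \<tau>) * eta \<tau>"])
    show "open H" unfolding H_def by (rule open_halfspace_Im_gt)
    show "connected H" unfolding H_def by (intro convex_connected convex_halfspace_Im_gt)
    show "(\<lambda>\<tau>. eta (- 1 / \<tau>) - csqrt (- \<i> * \<tau>) * eta \<tau>) holomorphic_on H"
    proof -
      have "(\<lambda>\<tau>. eta (- 1 / \<tau>)) holomorphic_on H"
        by (rule holomorphic_on_compose_gen[OF _ holomorphic_eta, unfolded o_def])
           (use Im_inv nz in \<open>auto intro!: holomorphic_intros\<close>)
      moreover have "eta holomorphic_on H" unfolding H_def by (rule holomorphic_eta)
      moreover have "(\<lambda>\<tau>. csqrt (- \<i> * \<tau>)) holomorphic_on H"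
        by (intro holomorphic_on_csqrt' holomorphic_intros) (auto simp: H_def complex_nonpos_Reals_iff)
      ultimately show ?thesis by (intro holomorphic_on_diff holomorphic_on_mult)
    qed
    show "U \<subseteq> H" by (auto simp: U_def H_def)
    show "\<i> \<in> H" by (simp add: H_def)
    show "\<i> islimpt U" unfolding islimpt_approachable
    proof (intro allI impI)
      fix e :: real assume e: "e > 0"
      define w where "w = \<i> * complex_of_real (1 + e / 2)"
      have "w - \<i> = \<i> * complex_of_real (e / 2)" by (simp add: w_def algebra_simps)
      hence "dist w \<i> = norm (\<i> * complex_of_real (e / 2))" by (simp only: dist_norm)
      also have "\<dots> = e / 2" using e by (simp add: norm_mult)
      finally have "dist w \<i> = e / 2" .
      moreover from this have "w \<noteq> \<i>" using e by auto
      moreover have "w \<in> U" unfolding U_def w_def using e by (intro imageI) simp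
      ultimately show "\<exists>x'\<in>U. x' \<noteq> \<i> \<and> dist x' \<i> < e" using e by (intro bexI[of _ w]) simp_all
    qed
    show "eta (- 1 / z) - csqrt (- \<i> * z) * eta z = 0" if "z \<in> U" for z
    proof -
      obtain y where y: "y > 0" "z = \<i> * of_real y" using \<open>z \<in> U\<close> by (auto simp: U_def)
      have e1: "- 1 / z = \<i> / of_real y" using y(1) unfolding y(2) by (simp add: field_simps)
      have "- \<i> * z = of_real y" unfolding y(2) by simp
      hence e2: "csqrt (- \<i> * z) = of_real (sqrt y)"
        using y(1) by (simp only: of_real_sqrt less_imp_le)
      show ?thesis
        unfolding e1 e2 eta_inversion_imag[OF y(1)] by (simp only: y(2) diff_self)
    qed
    show "\<tau> \<in> H" using assms by (simp add: H_def)
  qed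
  thus ?thesis by simp
qed

section \<open>Square roots and nonvanishing\<close>

text \<open>The automorphy factor of \<open>eta\<close> under inversion: the branch of $\sqrt{u/i}$ with positive real part.\<close>

definition hsqrt :: "complex \<Rightarrow> complex" where
  "hsqrt u = csqrt (- \<i> * u)"

lemma hsqrt_power2: "hsqrt u ^ 2 = - \<i> * u"
  by (simp only: hsqrt_def power2_csqrt)

text \<open>The value lies within angle pi/4 of the positive real axis. A product of two such values
  has positive real part, which reduces questions about branches to a comparison of squares.\<close>

lemma hsqrt_sector:
  assumes "Im u > 0"
  shows "\<bar>Im (hsqrt u)\<bar> < Re (hsqrt u)"
proof -
  have "Re (hsqrt u ^ 2) > 0" unfolding hsqrt_power2 using assms by simp
  hence "Im (hsqrt u) ^ 2 < Re (hsqrt u) ^ 2" by (simp add: Re_power2)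
  moreover have "Re (hsqrt u) \<ge> 0" unfolding hsqrt_def by (rule Re_csqrt)
  ultimately show ?thesis by (metis abs_le_square_iff abs_of_nonneg not_le)
qed

lemma hsqrt_cmult:
  assumes "r > 0" "Im u > 0"
  shows "hsqrt (of_real r * u) = of_real (sqrt r) * hsqrt u"
  unfolding hsqrt_def[of "of_real r * u"]
proof (rule csqrt_unique)
  have "complex_of_real (sqrt r) ^ 2 = of_real r" using assms by (simp flip: of_real_power)
  thus "(of_real (sqrt r) * hsqrt u) ^ 2 = - \<i> * (of_real r * u)"
    by (simp add: power_mult_distrib hsqrt_power2)
  have "Re (hsqrt u) > 0" using hsqrt_sector[OF assms(2)] by linarith
  thus "0 < Re (of_real (sqrt r) * hsqrt u) \<or> Re (of_real (sqrt r) * hsqrt u) = 0 \<and> 0 \<le> Im (of_real (sqrt r) * hsqrt u)"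
    using assms(1) by simp
qed

lemma square_eq_right_halfplane:
  fixes p r :: complex
  assumes "p ^ 2 = r ^ 2" "Re p > 0" "Re r > 0"
  shows "p = r"
  using assms by (auto simp: power2_eq_iff)

lemma Re_mult_sector:
  fixes a b :: complex
  assumes "\<bar>Im a\<bar> < Re a" "\<bar>Im b\<bar> < Re b"
  shows "Re (a * b) > 0"
proof -
  have "\<bar>Im a\<bar> * \<bar>Im b\<bar> < Re a * Re b" using assms by (intro mult_strict_mono') auto
  hence "Im a * Im b < Re a * Re b" by (metis abs_mult abs_ge_self order_le_less_trans)
  thus ?thesis by simp
qed

definition zeta24 :: "int \<Rightarrow> complex" where
  "zeta24 n = exp (pi * \<i> * of_int n / 12)"

lemma zeta24_add: "zeta24 (m + n) = zeta24 m * zeta24 n"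
  by (simp add: zeta24_def ring_distribs add_divide_distrib exp_add)

lemma zeta24_values: "zeta24 0 = 1" "zeta24 6 = \<i>" "zeta24 (-6) = - \<i>"
  "zeta24 3 = of_real (sqrt 2 / 2) * (1 + \<i>)" "zeta24 (-3) = of_real (sqrt 2 / 2) * (1 - \<i>)"
proof -
  have *: "zeta24 n = cis (pi * of_int n / 12)" for n by (simp add: zeta24_def cis_conv_exp mult_ac)
  show "zeta24 0 = 1" "zeta24 6 = \<i>" "zeta24 (-6) = - \<i>" 
    by (simp_all add: * complex_eq_iff cos_60 sin_60)
  show "zeta24 3 = of_real (sqrt 2 / 2) * (1 + \<i>)" "zeta24 (-3) = of_real (sqrt 2 / 2) * (1 - \<i>)"
    by (simp_all add: * complex_eq_iff cos_45 sin_45)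
qed

lemma norm_zeta24: "norm (zeta24 n) = 1"
  by (simp add: zeta24_def)

text \<open>The phase is forced by (-i w)(-i z) = -i (-i w z). Turning the sector of
  \<open>hsqrt\<close> by -pi/4 leaves it in the right half-plane, so the sign is settled too. In
  \<open>hsqrt_mult'\<close> the product w z falls into the lower half-plane and the turn goes the
  other way.\<close>

lemma hsqrt_mult:
  assumes "Im w > 0" "Im z > 0" "Im (w * z) > 0"
  shows "hsqrt w * hsqrt z = zeta24 (-3) * hsqrt (w * z)"
proof (rule square_eq_right_halfplane)
  have "zeta24 (-3) ^ 2 = - \<i>" 
    unfolding power2_eq_square zeta24_add[symmetric] by (simp add: zeta24_values)
  thus "(hsqrt w * hsqrt z)\<^sup>2 = (zeta24 (- 3) * hsqrt (w * z))\<^sup>2"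
    by (simp only: power_mult_distrib hsqrt_power2) (simp add: mult_ac)
  show "Re (hsqrt w * hsqrt z) > 0"
    by (intro Re_mult_sector hsqrt_sector assms)
  have "Re (of_real a * (1 - \<i>) * h) = a * (Re h + Im h)" for a h by (simp add: algebra_simps)
  thus "Re (zeta24 (-3) * hsqrt (w * z)) > 0"
    unfolding zeta24_values using hsqrt_sector[OF assms(3)] by simp
qed

lemma hsqrt_mult':
  assumes "Im w > 0" "Im z > 0" "Im (- (w * z)) > 0"
  shows "hsqrt w * hsqrt z = zeta24 3 * hsqrt (- (w * z))"
proof (rule square_eq_right_halfplane)
  have "zeta24 3 ^ 2 = \<i>" 
    unfolding power2_eq_square zeta24_add[symmetric] by (simp add: zeta24_values)
  thus "(hsqrt w * hsqrt z)\<^sup>2 = (zeta24 3 * hsqrt (- (w * z)))\<^sup>2"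
    by (simp only: power_mult_distrib hsqrt_power2) (simp add: mult_ac)
  show "Re (hsqrt w * hsqrt z) > 0"
    by (intro Re_mult_sector hsqrt_sector assms)
  have "Re (of_real a * (1 + \<i>) * h) = a * (Re h - Im h)" for a h by (simp add: algebra_simps)
  thus "Re (zeta24 3 * hsqrt (- (w * z))) > 0"
    unfolding zeta24_values using hsqrt_sector[OF assms(3)] by simp
qed

section \<open>Translation, inversion and nonvanishing of eta\<close>

lemma eta_shift: "eta (\<tau> + of_int n) = zeta24 n * eta \<tau>"
proof -
  have "exp (2 * pi * \<i> * (\<tau> + of_int n)) = exp (2 * pi * \<i> * \<tau>) * exp (2 * pi * \<i> * of_int n)"
    by (simp add: ring_distribs exp_add)
  also have "exp (2 * pi * \<i> * of_int n) = 1"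
    using exp_integer_2pi[of "of_int n"] by (simp add: mult_ac)
  finally have 1: "exp (2 * pi * \<i> * (\<tau> + of_int n)) = exp (2 * pi * \<i> * \<tau>)" by simp
  have 2: "exp (pi * \<i> * (\<tau> + of_int n) / 12) = exp (pi * \<i> * \<tau> / 12) * zeta24 n"
    by (simp add: zeta24_def ring_distribs add_divide_distrib exp_add)
  show ?thesis unfolding eta_def 1 2 by simp
qed

lemma Im_inversion: "Im (- 1 / u) = Im u / norm u ^ 2"
  by (simp add: Im_divide cmod_power2)

lemma Im_inversion_pos: "Im u > 0 \<Longrightarrow> Im (- 1 / u) > 0"
  unfolding Im_inversion by (auto intro!: divide_pos_pos)

text \<open>One step of a continued fraction. The level 21 transformations are decomposed into such
  steps, and their eta multipliers are accumulated factor by factor.\<close>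

lemma eta_shift_inversion:
  assumes "Im u > 0"
  shows "eta (of_int n - 1 / u) = zeta24 n * hsqrt u * eta u"
proof -
  have "eta (- 1 / u + of_int n) = zeta24 n * (hsqrt u * eta u)"
    unfolding eta_shift eta_inversion[OF assms] hsqrt_def ..
  thus ?thesis by simp
qed

lemma eta_cnj:
  assumes "Im \<tau> > 0"
  shows "eta (- cnj \<tau>) = cnj (eta \<tau>)"
proof -
  have q: "exp (2 * pi * \<i> * - cnj \<tau>) = cnj (exp (2 * pi * \<i> * \<tau>))"
          "exp (pi * \<i> * - cnj \<tau> / 12) = cnj (exp (pi * \<i> * \<tau> / 12))"
    unfolding exp_cnj by simp_all
  have "ram_f (cnj z) = cnj (ram_f z)" if "norm z < 1" for z
  proof -
    have "(\<lambda>m. cnj (pent_coeff m * z ^ m)) sums cnj (ram_f z)"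
      unfolding sums_cnj by (rule has_sum_ram_f(2)[OF that])
    moreover have "cnj (pent_coeff m * z ^ m) = pent_coeff m * cnj z ^ m" for m
      by (simp add: pent_coeff_def minus_one_powi)
    ultimately have "(\<lambda>m. pent_coeff m * cnj z ^ m) sums cnj (ram_f z)" by (simp only:)
    moreover have "(\<lambda>m. pent_coeff m * cnj z ^ m) sums ram_f (cnj z)"
      by (rule has_sum_ram_f(2)) (simp add: that)
    ultimately show ?thesis by (rule sums_unique2[symmetric])
  qed
  thus ?thesis unfolding eta_def q using norm_nome_less[OF assms] by simp
qed

lemma ram_f_nonzero_small:
  assumes "norm q < 1 / 2"
  shows "ram_f q \<noteq> 0"
proof
  assume 0: "ram_f q = 0"
  have q: "norm q < 1" using assms by simp
  have "(\<lambda>m. pent_coeff (Suc m) * q ^ Suc m) sums (ram_f q - 1)"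
    using has_sum_ram_f(2)[OF q] by (subst sums_Suc_iff) (simp add: pent_coeff_small)
  hence eq: "(\<Sum>m. pent_coeff (Suc m) * q ^ Suc m) = -1" using 0 by (simp add: sums_iff)
  have g: "(\<lambda>m. norm q ^ Suc m) sums (1 / (1 - norm q) - 1)"
    using geometric_sums[of "norm q"] q by (subst sums_Suc_iff) simp
  have "norm (\<Sum>m. pent_coeff (Suc m) * q ^ Suc m) \<le> (\<Sum>m. norm q ^ Suc m)"
    using g by (intro norm_suminf_le) 
      (auto simp: norm_mult norm_power sums_iff intro!: mult_left_le_one_le norm_pent_coeff)
  also have "\<dots> = 1 / (1 - norm q) - 1" using g by (simp add: sums_iff)
  also have "\<dots> < 1" using assms by (simp add: field_simps)
  finally have "norm (\<Sum>m. pent_coeff (Suc m) * q ^ Suc m) < 1" .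
  moreover have "norm (\<Sum>m. pent_coeff (Suc m) * q ^ Suc m) = norm (-1 :: complex)"
    using eq by (simp only:)
  ultimately show False by simp
qed

text \<open>At height at least 0.8 the constant term of the series dominates. Below it, after a
  translation to |Re u| <= 1/2, one has |u|^2 <= 1/4 + 0.64 < 0.9, so inversion raises the height by
  a factor of at least 1/0.9 while \<open>eta\<close> only acquires a nonzero factor. The induction
  counts these steps.\<close>

lemma eta_nonzero:
  assumes "Im \<tau> > 0"
  shows "eta \<tau> \<noteq> 0"
proof -
  have *: "eta \<tau> \<noteq> 0" if "Im \<tau> \<ge> 0.8 * 0.9 ^ k" for k :: nat and \<tau>
    using that
  proof (induction k arbitrary: \<tau>)
    case 0
    have "2 * pi * Im \<tau> \<ge> 2 * 3 * 0.8" using 0 pi_gt3 by (intro mult_mono) auto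
    hence "exp (2 * pi * Im \<tau>) > 2"
      using exp_ge_add_one_self[of "2 * pi * Im \<tau>"] by linarith
    hence "norm (exp (2 * pi * \<i> * \<tau>)) < 1 / 2"
      by (simp add: exp_minus field_simps)
    from ram_f_nonzero_small[OF this] show ?case by (simp add: eta_def)
  next
    case (Suc k)
    show ?case
    proof (cases "Im \<tau> \<ge> 0.8")
      case True
      thus ?thesis using Suc.IH[of \<tau>] power_le_one[of "0.9::real" k] by simp
    next
      case False
      have pos: "Im \<tau> > 0" using Suc.prems by (rule less_le_trans[rotated]) simp
      define u where "u = \<tau> + of_int (- round (Re \<tau>))"
      have u: "Im u = Im \<tau>" "\<bar>Re u\<bar> \<le> 1 / 2"
        using of_int_round_abs_le[of "Re \<tau>"] by (auto simp: u_def abs_minus_commute)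
      have "norm u ^ 2 = Re u ^ 2 + Im u ^ 2" by (simp add: cmod_power2)
      also have "Re u ^ 2 \<le> (1 / 2) ^ 2" using u(2) by (metis abs_ge_zero power2_abs power_mono)
      also have "Im u ^ 2 \<le> 0.8 ^ 2" using False pos u(1) by (intro power_mono) auto
      finally have le: "norm u ^ 2 \<le> 0.9" by (simp add: power2_eq_square)
      have "u \<noteq> 0" using pos u(1) by auto
      hence "0.8 * 0.9 ^ k * norm u ^ 2 \<le> 0.8 * 0.9 ^ k * 0.9"
        using le by (intro mult_left_mono) auto
      also have "\<dots> \<le> Im u" using Suc.prems u(1) by (simp add: mult_ac)
      finally have "Im (- 1 / u) \<ge> 0.8 * 0.9 ^ k"
        unfolding Im_inversion using \<open>u \<noteq> 0\<close> by (simp add: field_simps)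
      hence "eta (- 1 / u) \<noteq> 0" by (rule Suc.IH)
      moreover have "eta (- 1 / u) = hsqrt u * eta u"
        unfolding hsqrt_def by (rule eta_inversion) (simp add: pos u(1))
      ultimately have "hsqrt u * eta u \<noteq> 0" by simp
      hence "eta u \<noteq> 0" by simp
      thus ?thesis unfolding u_def eta_shift by simp
    qed
  qed
  have "(\<lambda>k. 0.8 * 0.9 ^ k) \<longlonglongrightarrow> 0.8 * (0::real)"
    by (intro tendsto_intros LIMSEQ_power_zero) auto
  hence "eventually (\<lambda>k. 0.8 * 0.9 ^ k < Im \<tau>) sequentially"
    using assms by (intro order_tendstoD) auto
  then obtain k :: nat where "0.8 * 0.9 ^ k < Im \<tau>"
    by (auto simp: eventually_sequentially)
  thus ?thesis by (intro *[of k]) simp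
qed

lemma exists_nome:
  assumes "q \<noteq> 0" "norm q < 1"
  obtains \<tau> where "Im \<tau> > 0" "exp (2 * pi * \<i> * \<tau>) = q"
proof
  define \<tau> where "\<tau> = Ln q / (2 * pi * \<i>)"
  show "exp (2 * pi * \<i> * \<tau>) = q" using assms by (simp add: \<tau>_def)
  have "2 * pi * Im \<tau> = - Re (Ln q)"
    by (simp add: \<tau>_def Im_divide power2_eq_square field_simps)
  also have "\<dots> > 0" using assms by simp
  finally show "Im \<tau> > 0" by (simp add: zero_less_mult_iff)
qed

lemma ram_f_nonzero:
  assumes "norm q < 1"
  shows "ram_f q \<noteq> 0"
proof (cases "q = 0")
  case True
  thus ?thesis by (intro ram_f_nonzero_small) simp
next
  case False
  then obtain \<tau> where "Im \<tau> > 0" "exp (2 * pi * \<i> * \<tau>) = q"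
    using assms exists_nome by metis
  thus ?thesis using eta_nonzero[of \<tau>] by (simp add: eta_def)
qed

section \<open>A form of weight 8 and level 21\<close>

text \<open>For $a, b, c, d = \eta(\tau), \eta(3\tau), \eta(7\tau), \eta(21\tau)$, with $u = ac/(bd)$ and $x = ad/(bc)$, this is
  $(abcd)^4$ times $u^3 + 27u^{-3} - x^{-4} + 7x^{-2} - 7x^2 + x^4$.\<close>

definition eta_form :: "complex \<Rightarrow> complex \<Rightarrow> complex \<Rightarrow> complex \<Rightarrow> complex" where
  "eta_form a b c d = a^7 * c^7 * b * d + 27 * (a * c * b^7 * d^7) - b^8 * c^8
     + 7 * (b^6 * c^6 * a^2 * d^2) - 7 * (a^6 * d^6 * b^2 * c^2) + a^8 * d^8"

lemma eta_form_scale: "eta_form (k * a) (k * b) (k * c) (k * d) = k ^ 16 * eta_form a b c d"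
  by (simp add: eta_form_def power_mult_distrib algebra_simps power_add [symmetric]
        flip: power_Suc power_Suc2)

text \<open>With weights 1, 3, 7, 21 every monomial has total weight 80 modulo 24. This serves
  twice: z a 24th root of unity gives the effect of translations, and z = q^(1/24) gives the
  expansion at infinity.\<close>

lemma eta_form_weights:
  "eta_form (z * a) (z^3 * b) (z^7 * c) (z^21 * d) =
     z^80 * (a^7 * c^7 * b * d + 27 * ((z^24)^4 * (a * c * b^7 * d^7)) - b^8 * c^8
     + 7 * (z^24 * (b^6 * c^6 * a^2 * d^2)) - 7 * ((z^24)^3 * (a^6 * d^6 * b^2 * c^2)) + (z^24)^4 * (a^8 * d^8))"
proof -
  have "(z * a)^7 * (z^7 * c)^7 * (z^3 * b) * (z^21 * d) = z^80 * (a^7 * c^7 * b * d)"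
       "(z * a) * (z^7 * c) * (z^3 * b)^7 * (z^21 * d)^7 = z^80 * ((z^24)^4 * (a * c * b^7 * d^7))"
       "(z^3 * b)^8 * (z^7 * c)^8 = z^80 * (b^8 * c^8)"
       "(z^3 * b)^6 * (z^7 * c)^6 * (z * a)^2 * (z^21 * d)^2 = z^80 * (z^24 * (b^6 * c^6 * a^2 * d^2))"
       "(z * a)^6 * (z^21 * d)^6 * (z^3 * b)^2 * (z^7 * c)^2 = z^80 * ((z^24)^3 * (a^6 * d^6 * b^2 * c^2))"
       "(z * a)^8 * (z^21 * d)^8 = z^80 * ((z^24)^4 * (a^8 * d^8))"
    by algebra+
  thus ?thesis by (simp only: eta_form_def) (simp only: ring_distribs mult.left_commute[of _ "z^80"])
qed

lemma eta_form_shift: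
  assumes "z ^ 24 = 1"
  shows "eta_form (z * a) (z^3 * b) (z^7 * c) (z^21 * d) = z ^ 80 * eta_form a b c d"
  unfolding eta_form_weights assms by (simp add: eta_form_def)

text \<open>The substitutions in this and the next two lemmas are, up to a common factor, the effect on the eta values of
  the Fricke and two Atkin--Lehner involutions of level 21; the constants are $21^4$, $7^4$ and $3^4$.\<close>

lemma eta_form_fricke:
  assumes "s ^ 2 = 3" "t ^ 2 = 7"
  shows "eta_form (s * t * d) (t * c) (s * b) a = 194481 * eta_form a b c d"
proof -
  have "s ^ 8 = (s ^ 2) ^ 4" "s ^ 14 = (s ^ 2) ^ 7" by (simp_all flip: power_mult)
  hence s: "s ^ 8 = 81" "s ^ 14 = 81 * 27" by (simp_all add: assms)
  have "t ^ 8 = (t ^ 2) ^ 4" by (simp flip: power_mult)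
  hence t: "t ^ 8 = 2401" by (simp add: assms)
  have "(s * t * d)^7 * (s * b)^7 * (t * c) * a = s^14 * t^8 * (a * c * b^7 * d^7)"
       "(s * t * d) * (s * b) * (t * c)^7 * a^7 = s^2 * t^8 * (a^7 * c^7 * b * d)"
       "(t * c)^8 * (s * b)^8 = s^8 * t^8 * (b^8 * c^8)"
       "(t * c)^6 * (s * b)^6 * (s * t * d)^2 * a^2 = s^8 * t^8 * (b^6 * c^6 * a^2 * d^2)"
       "(s * t * d)^6 * a^6 * (t * c)^2 * (s * b)^2 = s^8 * t^8 * (a^6 * d^6 * b^2 * c^2)"
       "(s * t * d)^8 * a^8 = s^8 * t^8 * (a^8 * d^8)"
    by algebra+
  thus ?thesis unfolding eta_form_def s t assms(1)
    by (simp only:) (simp add: algebra_simps)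
qed

lemma ii_powers:
  "(- \<i> * x) ^ 2 = - (x ^ 2)" "(- \<i> * x) ^ 6 = - (x ^ 6)" "(- \<i> * x) ^ 7 = \<i> * x ^ 7" "(- \<i> * x) ^ 8 = x ^ 8"
  "(\<i> * x) ^ 2 = - (x ^ 2)" "(\<i> * x) ^ 6 = - (x ^ 6)" "(\<i> * x) ^ 7 = - \<i> * x ^ 7" "(\<i> * x) ^ 8 = x ^ 8"
proof -
  have "\<i> ^ 2 = -1" "\<i> ^ 6 = -1" "\<i> ^ 7 = - \<i>" "\<i> ^ 8 = 1"
    "(- \<i>) ^ 2 = -1" "(- \<i>) ^ 6 = -1" "(- \<i>) ^ 7 = \<i>" "(- \<i>) ^ 8 = 1"
    by (simp_all add: numeral_eq_Suc)
  thus "(- \<i> * x) ^ 2 = - (x ^ 2)" "(- \<i> * x) ^ 6 = - (x ^ 6)" "(- \<i> * x) ^ 7 = \<i> * x ^ 7" "(- \<i> * x) ^ 8 = x ^ 8"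
    "(\<i> * x) ^ 2 = - (x ^ 2)" "(\<i> * x) ^ 6 = - (x ^ 6)" "(\<i> * x) ^ 7 = - \<i> * x ^ 7" "(\<i> * x) ^ 8 = x ^ 8"
    by (simp_all only: power_mult_distrib) simp_all
qed

lemma eta_form_atkin_lehner_7:
  assumes "t ^ 2 = 7"
  shows "eta_form (t * c) (- \<i> * (t * d)) a (- \<i> * b) = - 2401 * eta_form a b c d"
proof -
  have "t ^ 8 = (t ^ 2) ^ 4" by (simp flip: power_mult)
  hence t: "t ^ 8 = 2401" by (simp add: assms)
  have i: "\<i>^2 = -1" by simp
  have "(t * c)^7 * a^7 * (- \<i> * (t * d)) * (- \<i> * b) = - (t^8 * (a^7 * c^7 * b * d))"
       "(t * c) * a * (- \<i> * (t * d))^7 * (- \<i> * b)^7 = - (t^8 * (a * c * b^7 * d^7))"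
       "(- \<i> * (t * d))^8 * a^8 = t^8 * (a^8 * d^8)"
       "(- \<i> * (t * d))^6 * a^6 * (t * c)^2 * (- \<i> * b)^2 = t^8 * (a^6 * d^6 * b^2 * c^2)"
       "(t * c)^6 * (- \<i> * b)^6 * (- \<i> * (t * d))^2 * a^2 = t^8 * (b^6 * c^6 * a^2 * d^2)"
       "(t * c)^8 * (- \<i> * b)^8 = t^8 * (b^8 * c^8)"
    unfolding ii_powers by (algebra add: i)+
  thus ?thesis unfolding eta_form_def t
    by (simp only:) (simp add: algebra_simps)
qed

lemma eta_form_atkin_lehner_3:
  assumes "s ^ 2 = 3"
  shows "eta_form (s * b) a (- \<i> * (s * d)) (\<i> * c) = - 81 * eta_form a b c d"
proof -
  have "s ^ 8 = (s ^ 2) ^ 4" "s ^ 14 = (s ^ 2) ^ 7" by (simp_all flip: power_mult)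
  hence s: "s ^ 8 = 81" "s ^ 14 = 81 * 27" by (simp_all add: assms)
  have i: "\<i>^2 = -1" by simp
  have "(s * b)^7 * (- \<i> * (s * d))^7 * a * (\<i> * c) = - (s^14 * (a * c * b^7 * d^7))"
       "(s * b) * (- \<i> * (s * d)) * a^7 * (\<i> * c)^7 = - (s^2 * (a^7 * c^7 * b * d))"
       "a^8 * (- \<i> * (s * d))^8 = s^8 * (a^8 * d^8)"
       "a^6 * (- \<i> * (s * d))^6 * (s * b)^2 * (\<i> * c)^2 = s^8 * (a^6 * d^6 * b^2 * c^2)"
       "(s * b)^6 * (\<i> * c)^6 * a^2 * (- \<i> * (s * d))^2 = s^8 * (b^6 * c^6 * a^2 * d^2)"
       "(s * b)^8 * (\<i> * c)^8 = s^8 * (b^8 * c^8)"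
    unfolding ii_powers by (algebra add: i)+
  thus ?thesis unfolding eta_form_def s assms
    by (simp only:) (simp add: algebra_simps)
qed

section \<open>Invariance of the weighted absolute value\<close>

definition level21_form :: "complex \<Rightarrow> complex" where
  "level21_form \<tau> = eta_form (eta \<tau>) (eta (3 * \<tau>)) (eta (7 * \<tau>)) (eta (21 * \<tau>))"

text \<open>The usual invariant y^(k/2) |F| of a form F of weight k = 8.\<close>

definition level21_norm :: "complex \<Rightarrow> real" where
  "level21_norm \<tau> = Im \<tau> ^ 4 * norm (level21_form \<tau>)"

lemma zeta24_power: "zeta24 (int k * n) = zeta24 n ^ k"
  by (induction k) (simp_all add: zeta24_values ring_distribs zeta24_add)

lemma zeta24_power_24: "zeta24 n ^ 24 = 1"
proof -
  have "zeta24 n ^ 24 = exp (2 * pi * \<i> * of_int n)"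
    unfolding zeta24_def exp_of_nat_mult [symmetric] by (rule arg_cong[where f = exp]) simp
  also have "\<dots> = 1" using exp_integer_2pi[of "of_int n"] by (simp add: mult_ac)
  finally show ?thesis .
qed

lemma level21_norm_shift: "level21_norm (\<tau> + of_int n) = level21_norm \<tau>"
proof -
  have e: "eta (of_nat k * (\<tau> + of_int n)) = zeta24 n ^ k * eta (of_nat k * \<tau>)" for k
  proof -
    have "of_nat k * (\<tau> + of_int n) = of_nat k * \<tau> + of_int (int k * n)"
      by (simp add: ring_distribs)
    thus ?thesis by (simp only: eta_shift zeta24_power)
  qed
  have "level21_form (\<tau> + of_int n) = zeta24 n ^ 80 * level21_form \<tau>"
    unfolding level21_form_def using e[of 1] e[of 3] e[of 7] e[of 21]
    by (simp add: eta_form_shift[OF zeta24_power_24])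
  thus ?thesis by (simp add: level21_norm_def norm_mult norm_power norm_zeta24)
qed

lemma level21_norm_reflect:
  assumes "Im \<tau> > 0"
  shows "level21_norm (- cnj \<tau>) = level21_norm \<tau>"
proof -
  have e: "eta (of_nat k * (- cnj \<tau>)) = cnj (eta (of_nat k * \<tau>))" if "k > 0" for k
    using eta_cnj[of "of_nat k * \<tau>"] assms that by simp
  have "level21_form (- cnj \<tau>) = cnj (level21_form \<tau>)"
    unfolding level21_form_def using e[of 1] e[of 3] e[of 7] e[of 21]
    by (simp add: eta_form_def)
  thus ?thesis by (simp add: level21_norm_def)
qed

lemma norm_hsqrt_16: "norm (hsqrt u ^ 16) = norm u ^ 8"
proof -
  have "hsqrt u ^ 16 = (hsqrt u ^ 2) ^ 8" by (simp flip: power_mult)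
  thus ?thesis unfolding hsqrt_power2 by (simp add: norm_mult norm_power)
qed

lemma of_real_sqrt_3_7: "complex_of_real (sqrt 3) ^ 2 = 3" "complex_of_real (sqrt 7) ^ 2 = 7"
  by (simp_all flip: of_real_power)

lemma Im_inversion_21: "Im (of_real a - 1 / (21 * u)) = Im u / (21 * norm u ^ 2)"
  using Im_inversion[of "21 * u"] by (simp add: norm_mult power_mult_distrib)

text \<open>The values at r tau and (21/r) tau are exchanged. Positive real factors come out of
  \<open>hsqrt\<close> as real square roots, so the four eta values share the single complex factor
  k, which homogeneity removes.\<close>

lemma level21_norm_fricke:
  assumes \<tau>: "Im \<tau> > 0"
  shows "level21_norm (- 1 / (21 * \<tau>)) = level21_norm \<tau>"
    and "Im (- 1 / (21 * \<tau>)) = Im \<tau> / (21 * norm \<tau> ^ 2)"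
proof -
  have nz: "\<tau> \<noteq> 0" using \<tau> by auto
  define k where "k = hsqrt \<tau>"
  define s t where "s = complex_of_real (sqrt 3)" and "t = complex_of_real (sqrt 7)"
  define \<tau>' where "\<tau>' = - 1 / (21 * \<tau>)"
  have inv: "eta (- 1 / (of_real r * \<tau>)) = of_real (sqrt r) * k * eta (of_real r * \<tau>)" if "r > 0" for r
    using eta_shift_inversion[of "of_real r * \<tau>" 0] that \<tau>
    by (simp add: hsqrt_cmult k_def zeta24_values)
  have "eta \<tau>' = k * (s * t * eta (21 * \<tau>))"
  proof -
    have "sqrt 21 = sqrt 3 * sqrt 7" by (simp flip: real_sqrt_mult)
    thus ?thesis using inv[of 21] by (simp add: \<tau>'_def s_def t_def mult_ac)
  qed
  moreover have "eta (3 * \<tau>') = k * (t * eta (7 * \<tau>))"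
    using inv[of 7] by (simp add: \<tau>'_def t_def mult_ac)
  moreover have "eta (7 * \<tau>') = k * (s * eta (3 * \<tau>))"
    using inv[of 3] by (simp add: \<tau>'_def s_def mult_ac)
  moreover have "eta (21 * \<tau>') = k * eta \<tau>"
    using inv[of 1] by (simp add: \<tau>'_def mult_ac)
  ultimately have "level21_form \<tau>' = k ^ 16 * (194481 * level21_form \<tau>)"
    unfolding level21_form_def by (simp only: eta_form_scale eta_form_fricke[OF of_real_sqrt_3_7, folded s_def t_def])
  hence n: "norm (level21_form \<tau>') = norm \<tau> ^ 8 * (21 ^ 4 * norm (level21_form \<tau>))"
    by (simp add: norm_mult norm_hsqrt_16 k_def)
  show im: "Im (- 1 / (21 * \<tau>)) = Im \<tau> / (21 * norm \<tau> ^ 2)"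
    using Im_inversion_21[of 0 \<tau>] by simp
  show "level21_norm (- 1 / (21 * \<tau>)) = level21_norm \<tau>"
    unfolding level21_norm_def n[unfolded \<tau>'_def] im using nz by (simp add: power_divide power_mult_distrib flip: power_mult)
qed

text \<open>The map is (-7 tau + 2)/(21 tau - 7), of determinant 7. It exchanges the eta values at
  tau and 7 tau, and those at 3 tau and 21 tau. The arguments 21 tau' and 3 tau' take one inversion
  step, while 7 tau' and tau' take two, for instance 7 tau' = -2 - 1/w with w = 3 - 1/tau; there w *
  tau = u merges the two square roots.\<close>

lemma level21_norm_atkin_lehner_7:
  assumes \<tau>: "Im \<tau> > 0"
  shows "level21_norm (- 1 / 3 - 1 / (21 * (3 * \<tau> - 1))) = level21_norm \<tau>"
    and "Im (- 1 / 3 - 1 / (21 * (3 * \<tau> - 1))) = Im \<tau> / (7 * norm (3 * \<tau> - 1) ^ 2)"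
proof -
  define u where "u = 3 * \<tau> - 1"
  have u: "Im u > 0" "u \<noteq> 0" using \<tau> by (auto simp: u_def complex_eq_iff)
  have \<tau>u: "\<tau> = (u + 1) / 3" by (simp add: u_def)
  have nz: "\<tau> \<noteq> 0" "7 * \<tau> - 2 \<noteq> 0" using \<tau> by (auto simp: complex_eq_iff)
  \<comment> \<open>The factor common to all four eta values. What is left over, apart from real
    factors, is the phase -i at 3 tau' and 21 tau', which \<open>eta_form_atkin_lehner_7\<close>
    takes into account.\<close>
  define k where "k = zeta24 (-2) * hsqrt u"
  define t where "t = complex_of_real (sqrt 7)"
  define \<tau>' where "\<tau>' = - 1 / 3 - 1 / (21 * u)"
  have 7: "hsqrt (7 * u) = t * hsqrt u" using hsqrt_cmult[of 7 u] u by (simp add: t_def)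
  have "eta (21 * \<tau>') = k * (- \<i> * eta (3 * \<tau>))"
  proof -
    have "21 * \<tau>' = of_int (-7) - 1 / u" using u(2) by (simp add: \<tau>'_def field_simps)
    hence "eta (21 * \<tau>') = zeta24 (-7) * hsqrt u * eta u" by (simp only: eta_shift_inversion u)
    also have "eta u = zeta24 (-1) * eta (3 * \<tau>)"
      using eta_shift[of "3 * \<tau>" "-1"] by (simp add: u_def)
    also have "zeta24 (-7) = zeta24 (-6) * zeta24 (-2) * zeta24 1"
      by (simp flip: zeta24_add)
    also have "zeta24 (-6) * zeta24 (-2) * zeta24 1 * hsqrt u * (zeta24 (-1) * eta (3 * \<tau>)) =
                 (zeta24 1 * zeta24 (-1)) * (zeta24 (-6) * k * eta (3 * \<tau>))"
      by (simp only: k_def mult_ac)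
    also have "zeta24 1 * zeta24 (-1) = 1" by (simp add: zeta24_values flip: zeta24_add)
    finally show ?thesis by (simp add: zeta24_values)
  qed
  moreover have "eta (3 * \<tau>') = k * (- \<i> * (t * eta (21 * \<tau>)))"
  proof -
    have "3 * \<tau>' = of_int (-1) - 1 / (7 * u)" using u(2) by (simp add: \<tau>'_def field_simps)
    moreover have "Im (7 * u) > 0" using u(1) by simp
    ultimately have "eta (3 * \<tau>') = zeta24 (-1) * hsqrt (7 * u) * eta (7 * u)"
      by (simp only: eta_shift_inversion)
    also have "eta (7 * u) = zeta24 (-7) * eta (21 * \<tau>)"
      using eta_shift[of "21 * \<tau>" "-7"] by (simp add: u_def algebra_simps)
    also have "zeta24 (-7) = zeta24 (-6) * zeta24 (-2) * zeta24 1"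
      by (simp flip: zeta24_add)
    also have "zeta24 (-1) * hsqrt (7 * u) * (zeta24 (-6) * zeta24 (-2) * zeta24 1 * eta (21 * \<tau>)) =
                 (zeta24 1 * zeta24 (-1)) * (zeta24 (-6) * k * t * eta (21 * \<tau>))"
      unfolding 7 k_def by (simp only: mult_ac)
    also have "zeta24 1 * zeta24 (-1) = 1" by (simp add: zeta24_values flip: zeta24_add)
    finally show ?thesis by (simp add: zeta24_values)
  qed
  moreover have "eta (7 * \<tau>') = k * eta \<tau>"
  proof -
    define w where "w = of_int 3 - 1 / \<tau>"
    have w\<tau>: "w * \<tau> = u" using nz by (simp add: w_def u_def field_simps)
    have w: "Im w > 0" using Im_inversion_pos[OF \<tau>] by (simp add: w_def)
    have "7 * \<tau>' = of_int (-2) - 1 / w"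
    proof -
      have "w = u / \<tau>" using w\<tau> nz by (simp add: field_simps)
      hence "of_int (-2) - 1 / w = - 2 - \<tau> / u" by simp
      also have "\<dots> = - 2 - ((u + 1) / 3) / u" by (simp only: \<tau>u [symmetric])
      also have "\<dots> = 7 * \<tau>'" using u(2) by (simp add: \<tau>'_def field_simps)
      finally show ?thesis ..
    qed
    hence "eta (7 * \<tau>') = zeta24 (-2) * hsqrt w * eta w" by (simp only: eta_shift_inversion w)
    also have "eta w = zeta24 3 * hsqrt \<tau> * eta \<tau>" unfolding w_def by (rule eta_shift_inversion[OF \<tau>])
    also have "zeta24 (-2) * hsqrt w * (zeta24 3 * hsqrt \<tau> * eta \<tau>) =
                 zeta24 (-2) * zeta24 3 * (hsqrt w * hsqrt \<tau>) * eta \<tau>"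
      by (simp only: mult_ac)
    also have "hsqrt w * hsqrt \<tau> = zeta24 (-3) * hsqrt u"
      using hsqrt_mult[OF w \<tau>] u by (simp add: w\<tau>)
    also have "zeta24 (-2) * zeta24 3 * (zeta24 (-3) * hsqrt u) * eta \<tau> = (zeta24 3 * zeta24 (-3)) * (k * eta \<tau>)"
      by (simp only: k_def mult_ac)
    also have "zeta24 3 * zeta24 (-3) = 1" unfolding zeta24_add[symmetric] by (simp add: zeta24_values)
    finally show ?thesis by simp
  qed
  moreover have "eta \<tau>' = k * (t * eta (7 * \<tau>))"
  proof -
    define \<sigma> where "\<sigma> = 7 * \<tau> - 2"
    define w where "w = of_int 3 - 1 / \<sigma>"
    have \<sigma>: "Im \<sigma> > 0" "\<sigma> \<noteq> 0" using \<tau> nz by (auto simp: \<sigma>_def)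
    have w\<sigma>: "w * \<sigma> = 7 * u" using \<sigma>(2) by (simp add: w_def field_simps) (simp add: \<sigma>_def u_def algebra_simps)
    have w: "Im w > 0" using Im_inversion_pos[OF \<sigma>(1)] by (simp add: w_def)
    have "\<tau>' = of_int 0 - 1 / w"
    proof -
      have "w = 7 * u / \<sigma>" using w\<sigma> \<sigma>(2) by (simp add: field_simps)
      hence "of_int 0 - 1 / w = - \<sigma> / (7 * u)" by simp
      also have "\<sigma> = (7 * u + 1) / 3" by (simp add: \<sigma>_def u_def)
      also have "- \<dots> / (7 * u) = \<tau>'" using u(2) by (simp add: \<tau>'_def field_simps)
      finally show ?thesis ..
    qed
    hence "eta \<tau>' = zeta24 0 * hsqrt w * eta w" by (simp only: eta_shift_inversion w)
    also have "eta w = zeta24 3 * hsqrt \<sigma> * eta \<sigma>" unfolding w_def by (rule eta_shift_inversion[OF \<sigma>(1)])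
    also have "eta \<sigma> = zeta24 (-2) * eta (7 * \<tau>)"
      using eta_shift[of "7 * \<tau>" "-2"] by (simp add: \<sigma>_def)
    also have "zeta24 0 * hsqrt w * (zeta24 3 * hsqrt \<sigma> * (zeta24 (-2) * eta (7 * \<tau>))) =
                 zeta24 (-2) * zeta24 3 * (hsqrt w * hsqrt \<sigma>) * eta (7 * \<tau>)"
      by (simp add: zeta24_values(1))
    also have "hsqrt w * hsqrt \<sigma> = zeta24 (-3) * (t * hsqrt u)"
      using hsqrt_mult[OF w \<sigma>(1)] u by (simp add: w\<sigma> 7)
    also have "zeta24 (-2) * zeta24 3 * (zeta24 (-3) * (t * hsqrt u)) * eta (7 * \<tau>) =
                 (zeta24 3 * zeta24 (-3)) * (k * (t * eta (7 * \<tau>)))"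
      by (simp only: k_def mult_ac)
    also have "zeta24 3 * zeta24 (-3) = 1" unfolding zeta24_add[symmetric] by (simp add: zeta24_values)
    finally show ?thesis by simp
  qed
  ultimately have "level21_form \<tau>' = k ^ 16 * (- 2401 * level21_form \<tau>)"
    unfolding level21_form_def
    by (simp only: eta_form_scale eta_form_atkin_lehner_7[OF of_real_sqrt_3_7(2), folded t_def])
  hence n: "norm (level21_form \<tau>') = norm u ^ 8 * (7 ^ 4 * norm (level21_form \<tau>))"
    by (simp add: norm_mult norm_hsqrt_16[unfolded norm_power] k_def norm_power norm_zeta24 power_mult_distrib)
  have im: "Im \<tau>' = Im \<tau> / (7 * norm u ^ 2)"
    using Im_inversion_21[of "-1/3" u] by (simp add: \<tau>'_def u_def)
  show "level21_norm (- 1 / 3 - 1 / (21 * (3 * \<tau> - 1))) = level21_norm \<tau>"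
    unfolding u_def[symmetric] \<tau>'_def[symmetric]
    unfolding level21_norm_def n im using u(2) by (simp add: power_divide power_mult_distrib flip: power_mult)
  show "Im (- 1 / 3 - 1 / (21 * (3 * \<tau> - 1))) = Im \<tau> / (7 * norm (3 * \<tau> - 1) ^ 2)"
    using im by (simp only: u_def \<tau>'_def)
qed

text \<open>The map is (9 tau - 4)/(21 tau - 9), of determinant 3. It exchanges tau with 3 tau and 7
  tau with 21 tau; the phases beyond the common factor are -i at 7 tau' and i at 21 tau'.\<close>

lemma level21_norm_atkin_lehner_3:
  assumes \<tau>: "Im \<tau> > 0"
  shows "level21_norm (3 / 7 - 1 / (21 * (7 * \<tau> - 3))) = level21_norm \<tau>"
    and "Im (3 / 7 - 1 / (21 * (7 * \<tau> - 3))) = Im \<tau> / (3 * norm (7 * \<tau> - 3) ^ 2)"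
proof -
  define v where "v = 7 * \<tau> - 3"
  have v: "Im v > 0" "v \<noteq> 0" using \<tau> by (auto simp: v_def complex_eq_iff)
  have nz: "\<tau> \<noteq> 0" using \<tau> by auto
  define k where "k = hsqrt v"
  define s where "s = complex_of_real (sqrt 3)"
  define \<tau>' where "\<tau>' = 3 / 7 - 1 / (21 * v)"
  have 3: "hsqrt (3 * v) = s * k" using hsqrt_cmult[of 3 v] v by (simp add: s_def k_def)
  have Im3: "Im (3 * v) > 0" using v(1) by simp
  have z33: "zeta24 (-3) * zeta24 3 = 1" unfolding zeta24_add[symmetric] by (simp add: zeta24_values)
  have "eta (21 * \<tau>') = k * (\<i> * eta (7 * \<tau>))"
  proof -
    have "21 * \<tau>' = of_int 9 - 1 / v" using v(2) by (simp add: \<tau>'_def field_simps)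
    hence "eta (21 * \<tau>') = zeta24 9 * k * eta v" by (simp only: eta_shift_inversion v k_def)
    also have "eta v = zeta24 (-3) * eta (7 * \<tau>)"
      using eta_shift[of "7 * \<tau>" "-3"] by (simp add: v_def)
    also have "zeta24 9 = zeta24 6 * zeta24 3" by (simp flip: zeta24_add)
    also have "zeta24 6 * zeta24 3 * k * (zeta24 (-3) * eta (7 * \<tau>)) =
                 (zeta24 (-3) * zeta24 3) * (k * (zeta24 6 * eta (7 * \<tau>)))"
      by (simp only: mult_ac)
    finally show ?thesis by (simp add: zeta24_values(2) z33)
  qed
  moreover have "eta (7 * \<tau>') = k * (- \<i> * (s * eta (21 * \<tau>)))"
  proof -
    have "7 * \<tau>' = of_int 3 - 1 / (3 * v)" using v(2) by (simp add: \<tau>'_def field_simps)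
    hence "eta (7 * \<tau>') = zeta24 3 * hsqrt (3 * v) * eta (3 * v)"
      by (simp only: eta_shift_inversion Im3)
    also have "eta (3 * v) = zeta24 (-9) * eta (21 * \<tau>)"
      using eta_shift[of "21 * \<tau>" "-9"] by (simp add: v_def algebra_simps)
    also have "zeta24 (-9) = zeta24 (-6) * zeta24 (-3)" by (simp flip: zeta24_add)
    also have "zeta24 3 * hsqrt (3 * v) * (zeta24 (-6) * zeta24 (-3) * eta (21 * \<tau>)) =
                 (zeta24 (-3) * zeta24 3) * (k * (zeta24 (-6) * s * eta (21 * \<tau>)))"
      unfolding 3 by (simp only: mult_ac)
    finally show ?thesis by (simp add: zeta24_values(3) z33)
  qed
  moreover have "eta (3 * \<tau>') = k * eta \<tau>"
  proof -
    \<comment> \<open>The continued fraction is 3 tau' = 1 - 1/(-3 - 1/(2 - 1/tau)). The partial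
      products are p = 2 tau - 1 and then -v, which lies in the lower half-plane; hence
      \<open>hsqrt_mult\<close> first and \<open>hsqrt_mult'\<close> second. All phases
      cancel.\<close>
    define w1 where "w1 = of_int 2 - 1 / \<tau>"
    define w2 where "w2 = of_int (-3) - 1 / w1"
    define p where "p = 2 * \<tau> - 1"
    have p: "w1 * \<tau> = p" "p \<noteq> 0" "Im p > 0"
      using nz \<tau> by (simp add: w1_def p_def field_simps, auto simp: p_def complex_eq_iff)
    have w1: "Im w1 > 0" using Im_inversion_pos[OF \<tau>] by (simp add: w1_def)
    have w1_eq: "w1 = p / \<tau>" using p nz by (simp add: field_simps)
    have w2: "Im w2 > 0" using Im_inversion_pos[OF w1] by (simp add: w2_def)
    have w2_eq: "w2 = - v / p"
      using p(2) nz unfolding w2_def w1_eq by (simp add: field_simps) (simp add: p_def v_def algebra_simps)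
    have w2p: "w2 * p = - v" using p(2) by (simp add: w2_eq)
    have "3 * \<tau>' = of_int 1 - 1 / w2"
    proof -
      have "of_int 1 - 1 / w2 = (v + p) / v" using v(2) p(2) by (simp add: w2_eq field_simps)
      also have "p = 2 * (v + 3) / 7 - 1" by (simp add: p_def v_def)
      also have "(v + (2 * (v + 3) / 7 - 1)) / v = 3 * \<tau>'" using v(2) by (simp add: \<tau>'_def field_simps)
      finally show ?thesis ..
    qed
    hence "eta (3 * \<tau>') = zeta24 1 * hsqrt w2 * eta w2" by (simp only: eta_shift_inversion w2)
    also have "eta w2 = zeta24 (-3) * hsqrt w1 * eta w1" unfolding w2_def by (rule eta_shift_inversion[OF w1])
    also have "eta w1 = zeta24 2 * hsqrt \<tau> * eta \<tau>" unfolding w1_def by (rule eta_shift_inversion[OF \<tau>])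
    also have "zeta24 1 * hsqrt w2 * (zeta24 (-3) * hsqrt w1 * (zeta24 2 * hsqrt \<tau> * eta \<tau>)) =
                 zeta24 1 * zeta24 2 * zeta24 (-3) * (hsqrt w2 * (hsqrt w1 * hsqrt \<tau>)) * eta \<tau>"
      by (simp only: mult_ac)
    also have "hsqrt w1 * hsqrt \<tau> = zeta24 (-3) * hsqrt p"
      using hsqrt_mult[OF w1 \<tau>] p by simp
    also have "hsqrt w2 * (zeta24 (-3) * hsqrt p) = zeta24 (-3) * (hsqrt w2 * hsqrt p)"
      by (simp only: mult_ac)
    also have "hsqrt w2 * hsqrt p = zeta24 3 * k"
      using hsqrt_mult'[OF w2 p(3)] v by (simp add: w2p k_def)
    also have "zeta24 1 * zeta24 2 = zeta24 3" by (simp flip: zeta24_add)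
    also have "zeta24 3 * zeta24 (-3) * (zeta24 (-3) * (zeta24 3 * k)) * eta \<tau> =
                 (zeta24 (-3) * zeta24 3) * ((zeta24 (-3) * zeta24 3) * (k * eta \<tau>))"
      by (simp only: mult_ac)
    finally show ?thesis by (simp add: z33)
  qed
  moreover have "eta \<tau>' = k * (s * eta (3 * \<tau>))"
  proof -
    define \<sigma> where "\<sigma> = 3 * \<tau> - 1"
    have \<sigma>: "Im \<sigma> > 0" "\<sigma> \<noteq> 0" using \<tau> by (auto simp: \<sigma>_def complex_eq_iff)
    define w1 where "w1 = of_int 3 - 1 / \<sigma>"
    define w2 where "w2 = of_int (-2) - 1 / w1"
    define p where "p = 3 * \<sigma> - 1"
    have p: "w1 * \<sigma> = p" "p \<noteq> 0" "Im p > 0"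
      using \<sigma> by (simp add: w1_def p_def field_simps, auto simp: p_def complex_eq_iff)
    have w1: "Im w1 > 0" using Im_inversion_pos[OF \<sigma>(1)] by (simp add: w1_def)
    have w1_eq: "w1 = p / \<sigma>" using p \<sigma> by (simp add: field_simps)
    have w2: "Im w2 > 0" using Im_inversion_pos[OF w1] by (simp add: w2_def)
    have w2_eq: "w2 = - (3 * v) / p"
      using p(2) \<sigma>(2) unfolding w2_def w1_eq by (simp add: field_simps) (simp add: p_def v_def \<sigma>_def algebra_simps)
    have w2p: "w2 * p = - (3 * v)" using p(2) by (simp add: w2_eq)
    have "\<tau>' = of_int 0 - 1 / w2"
    proof -
      have "of_int 0 - 1 / w2 = p / (3 * v)" using v(2) p(2) by (simp add: w2_eq field_simps)
      also have "p = 9 * (v + 3) / 7 - 4" by (simp add: p_def v_def \<sigma>_def)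
      also have "(9 * (v + 3) / 7 - 4) / (3 * v) = \<tau>'" using v(2) by (simp add: \<tau>'_def field_simps)
      finally show ?thesis ..
    qed
    hence "eta \<tau>' = zeta24 0 * hsqrt w2 * eta w2" by (simp only: eta_shift_inversion w2)
    also have "eta w2 = zeta24 (-2) * hsqrt w1 * eta w1" unfolding w2_def by (rule eta_shift_inversion[OF w1])
    also have "eta w1 = zeta24 3 * hsqrt \<sigma> * eta \<sigma>" unfolding w1_def by (rule eta_shift_inversion[OF \<sigma>(1)])
    also have "eta \<sigma> = zeta24 (-1) * eta (3 * \<tau>)"
      using eta_shift[of "3 * \<tau>" "-1"] by (simp add: \<sigma>_def)
    also have "zeta24 0 * hsqrt w2 * (zeta24 (-2) * hsqrt w1 * (zeta24 3 * hsqrt \<sigma> * (zeta24 (-1) * eta (3 * \<tau>)))) =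
                 (zeta24 (-2) * zeta24 (-1)) * zeta24 3 * (hsqrt w2 * (hsqrt w1 * hsqrt \<sigma>)) * eta (3 * \<tau>)"
      unfolding zeta24_values(1) mult_1_left by (simp only: mult_ac)
    also have "hsqrt w1 * hsqrt \<sigma> = zeta24 (-3) * hsqrt p"
      using hsqrt_mult[OF w1 \<sigma>(1)] p by simp
    also have "hsqrt w2 * (zeta24 (-3) * hsqrt p) = zeta24 (-3) * (hsqrt w2 * hsqrt p)"
      by (simp only: mult_ac)
    also have "hsqrt w2 * hsqrt p = zeta24 3 * (s * k)"
      using hsqrt_mult'[OF w2 p(3)] Im3 unfolding w2p minus_minus 3 by blast
    also have "zeta24 (-2) * zeta24 (-1) = zeta24 (-3)" by (simp flip: zeta24_add)
    also have "zeta24 (-3) * zeta24 3 * (zeta24 (-3) * (zeta24 3 * (s * k))) * eta (3 * \<tau>) =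
                 (zeta24 (-3) * zeta24 3) * ((zeta24 (-3) * zeta24 3) * (k * (s * eta (3 * \<tau>))))"
      by (simp only: mult_ac)
    finally show ?thesis by (simp add: z33)
  qed
  ultimately have "level21_form \<tau>' = k ^ 16 * (- 81 * level21_form \<tau>)"
    unfolding level21_form_def
    by (simp only: eta_form_scale eta_form_atkin_lehner_3[OF of_real_sqrt_3_7(1), folded s_def])
  hence n: "norm (level21_form \<tau>') = norm v ^ 8 * (3 ^ 4 * norm (level21_form \<tau>))"
    by (simp add: norm_mult norm_hsqrt_16 k_def)
  have im: "Im \<tau>' = Im \<tau> / (3 * norm v ^ 2)"
    using Im_inversion_21[of "3/7" v] by (simp add: \<tau>'_def v_def)
  show "level21_norm (3 / 7 - 1 / (21 * (7 * \<tau> - 3))) = level21_norm \<tau>"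
    unfolding v_def[symmetric] \<tau>'_def[symmetric]
    unfolding level21_norm_def n im using v(2) by (simp add: power_divide power_mult_distrib flip: power_mult)
  show "Im (3 / 7 - 1 / (21 * (7 * \<tau> - 3))) = Im \<tau> / (3 * norm (7 * \<tau> - 3) ^ 2)"
    using im by (simp only: v_def \<tau>'_def)
qed

section \<open>Reduction to bounded height and the expansion at infinity\<close>

lemma level21_norm_normalize_Re:
  assumes "Im \<tau> > 0"
  obtains u where "level21_norm u = level21_norm \<tau>" "Im u = Im \<tau>" "0 \<le> Re u" "Re u \<le> 1 / 2"
proof -
  define v where "v = \<tau> + of_int (- round (Re \<tau>))"
  have v: "level21_norm v = level21_norm \<tau>" "Im v = Im \<tau>" unfolding v_def level21_norm_shift by simp_all
  have "\<bar>Re v\<bar> \<le> 1 / 2"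
    using of_int_round_abs_le[of "Re \<tau>"] by (auto simp: v_def abs_minus_commute)
  show ?thesis
  proof (cases "Re v \<ge> 0")
    case True
    thus ?thesis using that[of v] v \<open>\<bar>Re v\<bar> \<le> 1 / 2\<close> by simp
  next
    case False
    moreover have "level21_norm (- cnj v) = level21_norm \<tau>" using level21_norm_reflect[of v] v assms by simp
    ultimately show ?thesis using that[of "- cnj v"] v \<open>\<bar>Re v\<bar> \<le> 1 / 2\<close> by simp
  qed
qed

lemma square_affine_bound:
  fixes x :: real
  assumes "a \<le> x" "x \<le> b" "\<bar>a\<bar> \<le> c" "\<bar>b\<bar> \<le> c"
  shows "x ^ 2 \<le> c ^ 2"
  by (rule abs_le_square_iff[THEN iffD1]) (use assms in linarith)

text \<open>The isometric circles of the three involutions, centred at $0$, $1/3$ and $3/7$, cover the part of height below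
  $0.04$ of the strip $0 \le \Re \tau \le 1/2$; the corners of this cover have height $\sqrt 3/42 > 0.041$.\<close>

lemma level21_norm_raise_Im:
  assumes "0 < Im \<tau>" "Im \<tau> < 0.04"
  obtains \<tau>' where "level21_norm \<tau>' = level21_norm \<tau>" "Im \<tau>' \<ge> Im \<tau> / 0.998"
proof -
  obtain u where u: "level21_norm u = level21_norm \<tau>" "Im u = Im \<tau>" "0 \<le> Re u" "Re u \<le> 1 / 2"
    using level21_norm_normalize_Re[OF assms(1)] .
  have pos: "Im u > 0" using u assms by simp
  have y2: "Im u ^ 2 \<le> 0.04 ^ 2" using u(2) assms by (intro power_mono) auto
  have improve: "Im u / d \<ge> Im \<tau> / 0.998" if "0 < d" "d \<le> 0.998" for d
    unfolding u(2) using that assms(1) by (intro divide_left_mono) auto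
  \<comment> \<open>The circles about 0 and 1/3 meet above 3/14, at height sqrt 3/42. The first case
    is the tightest: 21 ((3/14)^2 + 0.04^2) = 0.99789, and this determines the factor 0.998.\<close>
  consider "Re u \<le> 3 / 14" | "3 / 14 \<le> Re u" "Re u \<le> 3 / 7" | "3 / 7 \<le> Re u" by linarith
  thus ?thesis
  proof cases
    case 1
    have "u \<noteq> 0" using pos by auto
    have "Re u ^ 2 \<le> (3 / 14) ^ 2" using 1 u by (intro power_mono) auto
    moreover have "norm u ^ 2 = Re u ^ 2 + Im u ^ 2" by (simp add: cmod_power2)
    ultimately have "21 * norm u ^ 2 \<le> 0.998" using y2 by (simp add: power2_eq_square)
    thus ?thesis using that[OF level21_norm_fricke(1)[OF pos, unfolded u(1)]] improve[of "21 * norm u ^ 2"] \<open>u \<noteq> 0\<close>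
      unfolding level21_norm_fricke(2)[OF pos] by simp
  next
    case 2
    have nz: "3 * u - 1 \<noteq> 0" using pos by (auto simp: complex_eq_iff)
    have "(3 * Re u - 1) ^ 2 \<le> (5 / 14) ^ 2"
      by (rule square_affine_bound[where a = "-5/14" and b = "2/7"]) (use 2 in auto)
    moreover have "norm (3 * u - 1) ^ 2 = (3 * Re u - 1) ^ 2 + 9 * Im u ^ 2"
      by (simp add: cmod_power2 power_mult_distrib)
    ultimately have "7 * norm (3 * u - 1) ^ 2 \<le> 0.998" using y2 by (simp add: power2_eq_square)
    thus ?thesis using that[OF level21_norm_atkin_lehner_7(1)[OF pos, unfolded u(1)]] improve[of "7 * norm (3 * u - 1) ^ 2"] nz
      unfolding level21_norm_atkin_lehner_7(2)[OF pos] by simp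
  next
    case 3
    have nz: "7 * u - 3 \<noteq> 0" using pos by (auto simp: complex_eq_iff)
    have "(7 * Re u - 3) ^ 2 \<le> (1 / 2) ^ 2"
      by (rule square_affine_bound[where a = 0 and b = "1/2"]) (use 3 u in auto)
    moreover have "norm (7 * u - 3) ^ 2 = (7 * Re u - 3) ^ 2 + 49 * Im u ^ 2"
      by (simp add: cmod_power2 power_mult_distrib)
    ultimately have "3 * norm (7 * u - 3) ^ 2 \<le> 0.998" using y2 by (simp add: power2_eq_square)
    thus ?thesis using that[OF level21_norm_atkin_lehner_3(1)[OF pos, unfolded u(1)]] improve[of "3 * norm (7 * u - 3) ^ 2"] nz
      unfolding level21_norm_atkin_lehner_3(2)[OF pos] by simp
  qed
qed

text \<open>Every step gains the fixed factor 1/0.998, and this uniformity is what makes the number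
  of steps finite.\<close>

lemma level21_norm_reduction:
  assumes "Im \<tau> > 0"
  obtains \<tau>' where "level21_norm \<tau>' = level21_norm \<tau>" "Im \<tau>' \<ge> 0.04"
proof -
  have *: "\<exists>\<tau>'. level21_norm \<tau>' = level21_norm \<tau> \<and> Im \<tau>' \<ge> 0.04" if "Im \<tau> \<ge> 0.04 * 0.998 ^ k" for k :: nat and \<tau>
    using that
  proof (induction k arbitrary: \<tau>)
    case 0
    thus ?case by auto
  next
    case (Suc k)
    have pos: "Im \<tau> > 0" using Suc.prems by (rule less_le_trans[rotated]) simp
    show ?case
    proof (cases "Im \<tau> \<ge> 0.04")
      case False
      then obtain \<tau>' where \<tau>': "level21_norm \<tau>' = level21_norm \<tau>" "Im \<tau>' \<ge> Im \<tau> / 0.998"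
        using level21_norm_raise_Im[of \<tau>] pos by (metis not_le)
      have "0.04 * 0.998 ^ k \<le> Im \<tau> / 0.998" using Suc.prems by (simp add: field_simps)
      hence "Im \<tau>' \<ge> 0.04 * 0.998 ^ k" using \<tau>'(2) by linarith
      from Suc.IH[OF this] show ?thesis using \<tau>'(1) by simp
    qed auto
  qed
  have "(\<lambda>k. 0.04 * 0.998 ^ k) \<longlonglongrightarrow> 0.04 * (0::real)"
    by (intro tendsto_intros LIMSEQ_power_zero) auto
  hence "eventually (\<lambda>k. 0.04 * 0.998 ^ k < Im \<tau>) sequentially"
    using assms by (intro order_tendstoD) auto
  then obtain k :: nat where "0.04 * 0.998 ^ k < Im \<tau>"
    by (auto simp: eventually_sequentially)
  thus ?thesis using *[of k \<tau>] that by auto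
qed

section \<open>Expansions modulo q^13\<close>

definition X13 :: "complex poly" where
  "X13 = [:0, 0, 0, 0, 0, 0, 0, 0, 0, 0, 0, 0, 0, 1:]"

lemma poly_X13: "poly X13 q = q ^ 13"
  by (simp add: X13_def numeral_eq_Suc)

text \<open>A congruence modulo q^13 between functions, with a quotient that is holomorphic on the
  whole unit disc.\<close>

definition trunc13 :: "(complex \<Rightarrow> complex) \<Rightarrow> complex poly \<Rightarrow> bool" where
  "trunc13 u p \<longleftrightarrow> (\<exists>h. h holomorphic_on ball 0 1 \<and> (\<forall>q\<in>ball 0 1. u q = poly p q + q ^ 13 * h q))"

lemma trunc13I:
  assumes "h holomorphic_on ball 0 1" "\<And>q. norm q < 1 \<Longrightarrow> u q = poly p q + q ^ 13 * h q"
  shows "trunc13 u p"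
  using assms unfolding trunc13_def by (intro exI[of _ h]) auto

lemma trunc13_exact: "(\<And>q. u q = poly p q) \<Longrightarrow> trunc13 u p"
  by (rule trunc13I[of "\<lambda>_. 0"]) auto

text \<open>The polynomial s is the overflow of the product beyond degree 12. Supplied as a witness,
  it makes truncation an identity between explicit coefficient lists, which simplification can
  check.\<close>

lemma trunc13_mult:
  assumes "trunc13 u p" "trunc13 v r" "p * r = t + X13 * s"
  shows "trunc13 (\<lambda>q. u q * v q) t"
proof -
  obtain h k where h: "h holomorphic_on ball 0 1" "\<And>q. norm q < 1 \<Longrightarrow> u q = poly p q + q ^ 13 * h q"
    and k: "k holomorphic_on ball 0 1" "\<And>q. norm q < 1 \<Longrightarrow> v q = poly r q + q ^ 13 * k q"
    using assms(1,2) unfolding trunc13_def by auto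
  show ?thesis
  proof (rule trunc13I)
    show "(\<lambda>q. poly s q + poly p q * k q + poly r q * h q + q ^ 13 * (h q * k q)) holomorphic_on ball 0 1"
      by (intro holomorphic_intros h(1) k(1)) 
    fix q :: complex assume q: "norm q < 1"
    have pr: "poly p q * poly r q = poly t q + q ^ 13 * poly s q"
      using arg_cong[OF assms(3), of "\<lambda>p. poly p q"] by (simp add: poly_X13)
    have "u q * v q = (poly p q + q ^ 13 * h q) * (poly r q + q ^ 13 * k q)" using h(2) k(2) q by simp
    also have "\<dots> = poly p q * poly r q + q ^ 13 * (poly p q * k q + poly r q * h q + q ^ 13 * (h q * k q))"
      by (simp add: ring_distribs mult_ac)
    finally show "u q * v q = poly t q + q ^ 13 * (poly s q + poly p q * k q + poly r q * h q + q ^ 13 * (h q * k q))"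
      unfolding pr by (simp add: ring_distribs)
  qed
qed

lemma trunc13_power_mult:
  assumes "trunc13 (\<lambda>q. u q ^ m) p" "trunc13 (\<lambda>q. u q ^ n) r" "p * r = t + X13 * s" "m + n = k"
  shows "trunc13 (\<lambda>q. u q ^ k) t"
  using trunc13_mult[OF assms(1-3)] assms(4) by (simp flip: power_add)

lemma trunc13_add:
  assumes "trunc13 u p" "trunc13 v r"
  shows "trunc13 (\<lambda>q. u q + v q) (p + r)"
proof -
  obtain h k where h: "h holomorphic_on ball 0 1" "\<And>q. norm q < 1 \<Longrightarrow> u q = poly p q + q ^ 13 * h q"
    and k: "k holomorphic_on ball 0 1" "\<And>q. norm q < 1 \<Longrightarrow> v q = poly r q + q ^ 13 * k q"
    using assms unfolding trunc13_def by auto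
  show ?thesis
    by (rule trunc13I[of "\<lambda>q. h q + k q"]) (auto intro!: holomorphic_intros h(1) k(1) simp: h k ring_distribs)
qed

lemma trunc13_cmult:
  assumes "trunc13 u p"
  shows "trunc13 (\<lambda>q. c * u q) (smult c p)"
proof -
  obtain h where h: "h holomorphic_on ball 0 1" "\<And>q. norm q < 1 \<Longrightarrow> u q = poly p q + q ^ 13 * h q"
    using assms unfolding trunc13_def by auto
  show ?thesis
    by (rule trunc13I[of "\<lambda>q. c * h q"]) (auto intro!: holomorphic_intros h(1) simp: h ring_distribs)
qed

definition level21_series :: "complex \<Rightarrow> complex" where
  "level21_series q = (let a = ram_f q; b = ram_f (q ^ 3); c = ram_f (q ^ 7); d = ram_f (q ^ 21) in
     a^7 * c^7 * b * d + 27 * (q^4 * (a * c * b^7 * d^7)) - b^8 * c^8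
     + 7 * (q * (b^6 * c^6 * a^2 * d^2)) - 7 * (q^3 * (a^6 * d^6 * b^2 * c^2)) + q^4 * (a^8 * d^8))"

lemma holomorphic_power_map: "k > 0 \<Longrightarrow> h holomorphic_on ball 0 1 \<Longrightarrow> (\<lambda>q. h (q ^ k)) holomorphic_on ball 0 1"
  by (rule holomorphic_on_compose_gen[of "\<lambda>q. q ^ k" _ h "ball 0 1", unfolded o_def])
     (auto intro!: holomorphic_intros simp: norm_power power_less_one_iff)

text \<open>The only numerical verification behind Ramanujan's relation: the coefficients of q^0 to
  q^12 cancel.\<close>

lemma trunc13_level21_series: "trunc13 level21_series 0"
proof -
  define f1 f3 f7 f21 where "f1 = ram_f" and "f3 = (\<lambda>q. ram_f (q ^ 3))"
    and "f7 = (\<lambda>q. ram_f (q ^ 7))" and "f21 = (\<lambda>q. ram_f (q ^ 21))"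
  obtain h where h: "h holomorphic_on ball 0 1"
    "\<And>q. norm q < 1 \<Longrightarrow> ram_f q = 1 - q - q^2 + q^5 + q^7 - q^12 + q^13 * h q"
    using ram_f_expansion by blast
  have hk: "ram_f (q ^ k) = 1 - q^k - (q^k)^2 + (q^k)^5 + (q^k)^7 - (q^k)^12 + (q^k)^13 * h (q^k)"
    if "norm q < 1" "k > 0" for q k
    by (rule h(2)) (use that in \<open>simp add: norm_power power_less_one_iff\<close>)
  have f11: "trunc13 (\<lambda>q. f1 q ^ 1) [:1, -1, -1, 0, 0, 1, 0, 1, 0, 0, 0, 0, -1:]"
    by (rule trunc13I[OF h(1)]) (simp add: f1_def h(2), simp add: numeral_eq_Suc algebra_simps)
  have f31: "trunc13 (\<lambda>q. f3 q ^ 1) [:1, 0, 0, -1, 0, 0, -1:]"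
  proof (rule trunc13I)
    show "(\<lambda>q. q^2 + q^8 - q^23 + q^26 * h (q^3)) holomorphic_on ball 0 1"
      by (intro holomorphic_intros holomorphic_power_map h(1)) auto
    fix q :: complex assume q: "norm q < 1"
    show "f3 q ^ 1 = poly [:1, 0, 0, -1, 0, 0, -1:] q + q^13 * (q^2 + q^8 - q^23 + q^26 * h (q^3))"
      using hk[OF q, of 3] by (simp add: f3_def) (simp add: numeral_eq_Suc algebra_simps)
  qed
  have f71: "trunc13 (\<lambda>q. f7 q ^ 1) [:1, 0, 0, 0, 0, 0, 0, -1:]"
  proof (rule trunc13I)
    show "(\<lambda>q. - q + q^22 + q^36 - q^71 + q^78 * h (q^7)) holomorphic_on ball 0 1"
      by (intro holomorphic_intros holomorphic_power_map h(1)) auto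
    fix q :: complex assume q: "norm q < 1"
    show "f7 q ^ 1 = poly [:1, 0, 0, 0, 0, 0, 0, -1:] q + q^13 * (- q + q^22 + q^36 - q^71 + q^78 * h (q^7))"
      using hk[OF q, of 7] by (simp add: f7_def) (simp add: numeral_eq_Suc algebra_simps)
  qed
  have f211: "trunc13 (\<lambda>q. f21 q ^ 1) [:1:]"
  proof (rule trunc13I)
    show "(\<lambda>q. - (q^8) - q^29 + q^92 + q^134 - q^239 + q^260 * h (q^21)) holomorphic_on ball 0 1"
      by (intro holomorphic_intros holomorphic_power_map h(1)) auto
    fix q :: complex assume q: "norm q < 1"
    show "f21 q ^ 1 = poly [:1:] q + q^13 * (- (q^8) - q^29 + q^92 + q^134 - q^239 + q^260 * h (q^21))"
      using hk[OF q, of 21] by (simp add: f21_def ring_distribs flip: power_mult power_add)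
  qed
  have x1: "trunc13 (\<lambda>q. q ^ 1) [:0, 1:]" and x3: "trunc13 (\<lambda>q. q ^ 3) [:0, 0, 0, 1:]"
    and x4: "trunc13 (\<lambda>q. q ^ 4) [:0, 0, 0, 0, 1:]"
    by (rule trunc13_exact; simp add: numeral_eq_Suc)+
  \<comment> \<open>The name \<open>f\<close> followed by j and k stands for the k-th power of the
    series in q^j. The witnesses list the coefficients from q^13 on in the product of the two
    truncated factors.\<close>
  have f12: "trunc13 (\<lambda>q. f1 q ^ 2) [:1, -2, -1, 2, 1, 2, -2, 0, -2, -2, 1:]"
    by (rule trunc13_power_mult[OF f11 f11, where s = "[:2, 3, 0, 0, -2, 0, -2, 0, 0, 0, 0, 1:]"]) (simp_all add: X13_def)
  have f14: "trunc13 (\<lambda>q. f1 q ^ 4) [:1, -4, 2, 8, -5, -4, -10, 8, 9, 0, 14, -16, -10:]"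
    by (rule trunc13_power_mult[OF f12 f12, where s = "[:-8, 2, 12, 0, 8, 0, -4, 1:]"]) (simp_all add: X13_def)
  have f16: "trunc13 (\<lambda>q. f1 q ^ 6) [:1, -6, 9, 10, -30, 0, 11, 42, 0, -70, 18, -54, 49:]"
    by (rule trunc13_power_mult[OF f14 f12, where s = "[:92, -3, -8, -114, 2, 1, 4, 66, 4, -10:]"]) (simp_all add: X13_def)
  have f17: "trunc13 (\<lambda>q. f1 q ^ 7) [:1, -7, 14, 7, -49, 21, 35, 41, -49, -133, 98, -21, 126:]"
    by (rule trunc13_power_mult[OF f16 f11, where s = "[:22, -86, 8, -94, 67, -65, 7, 0, 70, -18, 54, -49:]"]) (simp_all add: X13_def)
  have f18: "trunc13 (\<lambda>q. f1 q ^ 8) [:1, -8, 20, 0, -70, 64, 56, 0, -125, -160, 308, 0, 110:]"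
    by (rule trunc13_power_mult[OF f14 f14, where s = "[:8, -552, 32, 29, 624, 196, -448, 16, -448, -24, 320, 100:]"]) (simp_all add: X13_def)
  have f32: "trunc13 (\<lambda>q. f3 q ^ 2) [:1, 0, 0, -2, 0, 0, -1, 0, 0, 2, 0, 0, 1:]"
    by (rule trunc13_power_mult[OF f31 f31, where s = "0"]) (simp_all add: X13_def)
  have f34: "trunc13 (\<lambda>q. f3 q ^ 4) [:1, 0, 0, -4, 0, 0, 2, 0, 0, 8, 0, 0, -5:]"
    by (rule trunc13_power_mult[OF f32 f32, where s = "[:0, 0, -8, 0, 0, 2, 0, 0, 4, 0, 0, 1:]"]) (simp_all add: X13_def)
  have f36: "trunc13 (\<lambda>q. f3 q ^ 6) [:1, 0, 0, -6, 0, 0, 9, 0, 0, 10, 0, 0, -30:]"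
    by (rule trunc13_power_mult[OF f34 f32, where s = "[:0, 0, 2, 0, 0, 23, 0, 0, -2, 0, 0, -5:]"]) (simp_all add: X13_def)
  have f37: "trunc13 (\<lambda>q. f3 q ^ 7) [:1, 0, 0, -7, 0, 0, 14, 0, 0, 7, 0, 0, -49:]"
    by (rule trunc13_power_mult[OF f36 f31, where s = "[:0, 0, 20, 0, 0, 30:]"]) (simp_all add: X13_def)
  have f38: "trunc13 (\<lambda>q. f3 q ^ 8) [:1, 0, 0, -8, 0, 0, 20, 0, 0, 0, 0, 0, -70:]"
    by (rule trunc13_power_mult[OF f34 f34, where s = "[:0, 0, 72, 0, 0, 44, 0, 0, -80, 0, 0, 25:]"]) (simp_all add: X13_def)
  have f72: "trunc13 (\<lambda>q. f7 q ^ 2) [:1, 0, 0, 0, 0, 0, 0, -2:]"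
    by (rule trunc13_power_mult[OF f71 f71, where s = "[:0, 1:]"]) (simp_all add: X13_def)
  have f74: "trunc13 (\<lambda>q. f7 q ^ 4) [:1, 0, 0, 0, 0, 0, 0, -4:]"
    by (rule trunc13_power_mult[OF f72 f72, where s = "[:0, 4:]"]) (simp_all add: X13_def)
  have f76: "trunc13 (\<lambda>q. f7 q ^ 6) [:1, 0, 0, 0, 0, 0, 0, -6:]"
    by (rule trunc13_power_mult[OF f74 f72, where s = "[:0, 8:]"]) (simp_all add: X13_def)
  have f77: "trunc13 (\<lambda>q. f7 q ^ 7) [:1, 0, 0, 0, 0, 0, 0, -7:]"
    by (rule trunc13_power_mult[OF f76 f71, where s = "[:0, 6:]"]) (simp_all add: X13_def)
  have f78: "trunc13 (\<lambda>q. f7 q ^ 8) [:1, 0, 0, 0, 0, 0, 0, -8:]"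
    by (rule trunc13_power_mult[OF f74 f74, where s = "[:0, 16:]"]) (simp_all add: X13_def)
  have f212: "trunc13 (\<lambda>q. f21 q ^ 2) [:1:]"
    by (rule trunc13_power_mult[OF f211 f211, where s = "0"]) (simp_all add: X13_def)
  have f214: "trunc13 (\<lambda>q. f21 q ^ 4) [:1:]"
    by (rule trunc13_power_mult[OF f212 f212, where s = "0"]) (simp_all add: X13_def)
  have f216: "trunc13 (\<lambda>q. f21 q ^ 6) [:1:]"
    by (rule trunc13_power_mult[OF f214 f212, where s = "0"]) (simp_all add: X13_def)
  have f217: "trunc13 (\<lambda>q. f21 q ^ 7) [:1:]"
    by (rule trunc13_power_mult[OF f216 f211, where s = "0"]) (simp_all add: X13_def)
  have f218: "trunc13 (\<lambda>q. f21 q ^ 8) [:1:]"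
    by (rule trunc13_power_mult[OF f214 f214, where s = "0"]) (simp_all add: X13_def)
  have t1_0: "trunc13 (\<lambda>q. f1 q ^ 7 * f7 q ^ 7) [:1, -7, 14, 7, -49, 21, 35, 34, 0, -231, 49, 322, -21:]"
    by (rule trunc13_mult[OF f17 f77, where s = "[:-245, -287, 343, 931, -686, 147, -882:]"]) (simp_all add: X13_def)
  have t1_1: "trunc13 (\<lambda>q. f1 q ^ 7 * f7 q ^ 7 * f3 q ^ 1) [:1, -7, 14, 6, -42, 7, 27, 90, -35, -273, 64, 301, 175:]"
    by (rule trunc13_mult[OF t1_0 f31, where s = "[:-83, -322, 252, -49, -322, 21:]"]) (simp_all add: X13_def)
  have t1_2: "trunc13 (\<lambda>q. f1 q ^ 7 * f7 q ^ 7 * f3 q ^ 1 * f21 q ^ 1) [:1, -7, 14, 6, -42, 7, 27, 90, -35, -273, 64, 301, 175:]"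
    by (rule trunc13_mult[OF t1_1 f211, where s = "0"]) (simp_all add: X13_def)
  note t1 = t1_2
  have t2_0: "trunc13 (\<lambda>q. f1 q ^ 1 * f7 q ^ 1) [:1, -1, -1, 0, 0, 1, 0, 0, 1, 1, 0, 0, -2:]"
    by (rule trunc13_mult[OF f11 f71, where s = "[:0, -1, 0, 0, 0, 0, 1:]"]) (simp_all add: X13_def)
  have t2_1: "trunc13 (\<lambda>q. f1 q ^ 1 * f7 q ^ 1 * f3 q ^ 7) [:1, -1, -1, -7, 7, 8, 14, -14, -20, 8, -7, 0, -58:]"
    by (rule trunc13_mult[OF t2_0 f37, where s = "[:49, 70, 28, 0, -42, -21, 0, -49, -63, 0, 0, 98:]"]) (simp_all add: X13_def)
  have t2_2: "trunc13 (\<lambda>q. f1 q ^ 1 * f7 q ^ 1 * f3 q ^ 7 * f21 q ^ 7) [:1, -1, -1, -7, 7, 8, 14, -14, -20, 8, -7, 0, -58:]"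
    by (rule trunc13_mult[OF t2_1 f217, where s = "0"]) (simp_all add: X13_def)
  have t2: "trunc13 (\<lambda>q. q ^ 4 * (f1 q ^ 1 * f7 q ^ 1 * f3 q ^ 7 * f21 q ^ 7)) [:0, 0, 0, 0, 1, -1, -1, -7, 7, 8, 14, -14, -20:]"
    by (rule trunc13_mult[OF x4 t2_2, where s = "[:8, -7, 0, -58:]"]) (simp_all add: X13_def)
  have t3_0: "trunc13 (\<lambda>q. f3 q ^ 8 * f7 q ^ 8) [:1, 0, 0, -8, 0, 0, 20, -8, 0, 0, 64, 0, -70:]"
    by (rule trunc13_mult[OF f38 f78, where s = "[:-160, 0, 0, 0, 0, 0, 560:]"]) (simp_all add: X13_def)
  note t3 = t3_0
  have t4_0: "trunc13 (\<lambda>q. f3 q ^ 6 * f7 q ^ 6) [:1, 0, 0, -6, 0, 0, 9, -6, 0, 10, 36, 0, -30:]"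
    by (rule trunc13_mult[OF f36 f76, where s = "[:-54, 0, 0, -60, 0, 0, 180:]"]) (simp_all add: X13_def)
  have t4_1: "trunc13 (\<lambda>q. f3 q ^ 6 * f7 q ^ 6 * f1 q ^ 2) [:1, -2, -1, -4, 13, 8, -5, -30, -11, 44, 14, -58, -64:]"
    by (rule trunc13_mult[OF t4_0 f12, where s = "[:148, 68, -14, -81, -86, -32, -62, 96, 60, -30:]"]) (simp_all add: X13_def)
  have t4_2: "trunc13 (\<lambda>q. f3 q ^ 6 * f7 q ^ 6 * f1 q ^ 2 * f21 q ^ 2) [:1, -2, -1, -4, 13, 8, -5, -30, -11, 44, 14, -58, -64:]"
    by (rule trunc13_mult[OF t4_1 f212, where s = "0"]) (simp_all add: X13_def)
  have t4: "trunc13 (\<lambda>q. q ^ 1 * (f3 q ^ 6 * f7 q ^ 6 * f1 q ^ 2 * f21 q ^ 2)) [:0, 1, -2, -1, -4, 13, 8, -5, -30, -11, 44, 14, -58:]"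
    by (rule trunc13_mult[OF x1 t4_2, where s = "[:-64:]"]) (simp_all add: X13_def)
  have t5_0: "trunc13 (\<lambda>q. f1 q ^ 6 * f21 q ^ 6) [:1, -6, 9, 10, -30, 0, 11, 42, 0, -70, 18, -54, 49:]"
    by (rule trunc13_mult[OF f16 f216, where s = "0"]) (simp_all add: X13_def)
  have t5_1: "trunc13 (\<lambda>q. f1 q ^ 6 * f21 q ^ 6 * f3 q ^ 2) [:1, -6, 9, 8, -18, -18, -10, 108, -9, -100, -48, -36, 199:]"
    by (rule trunc13_mult[OF t5_0 f32, where s = "[:-144, 117, 4, 36, 54, -178, 78, -108, 28, 18, -54, 49:]"]) (simp_all add: X13_def)
  have t5_2: "trunc13 (\<lambda>q. f1 q ^ 6 * f21 q ^ 6 * f3 q ^ 2 * f7 q ^ 2) [:1, -6, 9, 8, -18, -18, -10, 106, 3, -118, -64, 0, 235:]"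
    by (rule trunc13_mult[OF t5_1 f72, where s = "[:20, -216, 18, 200, 96, 72, -398:]"]) (simp_all add: X13_def)
  have t5: "trunc13 (\<lambda>q. q ^ 3 * (f1 q ^ 6 * f21 q ^ 6 * f3 q ^ 2 * f7 q ^ 2)) [:0, 0, 0, 1, -6, 9, 8, -18, -18, -10, 106, 3, -118:]"
    by (rule trunc13_mult[OF x3 t5_2, where s = "[:-64, 0, 235:]"]) (simp_all add: X13_def)
  have t6_0: "trunc13 (\<lambda>q. f1 q ^ 8 * f21 q ^ 8) [:1, -8, 20, 0, -70, 64, 56, 0, -125, -160, 308, 0, 110:]"
    by (rule trunc13_mult[OF f18 f218, where s = "0"]) (simp_all add: X13_def)
  have t6: "trunc13 (\<lambda>q. q ^ 4 * (f1 q ^ 8 * f21 q ^ 8)) [:0, 0, 0, 0, 1, -8, 20, 0, -70, 64, 56, 0, -125:]"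
    by (rule trunc13_mult[OF x4 t6_0, where s = "[:-160, 308, 0, 110:]"]) (simp_all add: X13_def)
  \<comment> \<open>The lists of the six monomials, with weights 1, 27, -1, 7, -7, 1, now sum to the
    zero polynomial.\<close>
  note lin = trunc13_add[OF trunc13_add[OF trunc13_add[OF trunc13_add[OF trunc13_add[OF t1
      trunc13_cmult[OF t2, of 27]] trunc13_cmult[OF t3, of "-1"]] trunc13_cmult[OF t4, of 7]] 
      trunc13_cmult[OF t5, of "-7"]] t6]
  show ?thesis using lin
    by (simp add: level21_series_def[abs_def] Let_def f1_def f3_def f7_def f21_def)
qed

section \<open>The eta quotient relation of level 21\<close>

text \<open>Write g(w) = 1/w^2 - 7/w + 7w - w^2. The double factor is explained by g(1/w) = -g(w):
  at P = -1 the arguments PQ and P/Q are reciprocal, the last term vanishes doubly, and the rest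
  becomes -(g(PQ) + g(P/Q))^2. With p and r for the reciprocals of P and Q the claim is polynomial
  modulo P p = Q r = 1.\<close>

lemma factorization_identity:
  fixes P Q :: complex
  assumes "P \<noteq> 0" "Q \<noteq> 0"
  defines "T \<equiv> P ^ 6 + 1 / P ^ 6 + Q ^ 4 + 1 / Q ^ 4 -
     (49 * (Q ^ 2 + 1 / Q ^ 2) - 28 * (Q + 1 / Q) - 464
    + (P ^ 5 + 1 / P ^ 5) * (29 + 7 * (Q + 1 / Q))
    - (P ^ 4 + 1 / P ^ 4) * (106 + 14 * (Q + 1 / Q))
    + (P ^ 3 + 1 / P ^ 3) *
        (183 + 21 * (Q + 1 / Q) - 7 * (Q ^ 3 + 1 / Q ^ 3) + (Q ^ 4 + 1 / Q ^ 4))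
    - (P ^ 2 + 1 / P ^ 2) *
        (260 + 28 * (Q + 1 / Q) - 49 * (Q ^ 2 + 1 / Q ^ 2) + (Q ^ 4 + 1 / Q ^ 4))
    + (P + 1 / P) *
        (337 + 35 * (Q + 1 / Q) - 49 * (Q ^ 2 + 1 / Q ^ 2) + (Q ^ 4 + 1 / Q ^ 4)))"
  shows "P * ((1 / (P * Q) ^ 2 - 7 / (P * Q) + 7 * (P * Q) - (P * Q) ^ 2) *
              (1 / (P / Q) ^ 2 - 7 / (P / Q) + 7 * (P / Q) - (P / Q) ^ 2) * (P ^ 3 + 1 / P ^ 3)
            - (1 / (P * Q) ^ 2 - 7 / (P * Q) + 7 * (P * Q) - (P * Q) ^ 2) ^ 2
            - (1 / (P / Q) ^ 2 - 7 / (P / Q) + 7 * (P / Q) - (P / Q) ^ 2) ^ 2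
            - 27 * (P ^ 3 - 1 / P ^ 3) ^ 2) = (P + 1) ^ 2 * T"
proof -
  define p r where "p = 1 / P" and "r = 1 / Q"
  have pr: "P * p = 1" "Q * r = 1" using assms(1,2) by (simp_all add: p_def r_def)
  have e: "1 / P ^ k = p ^ k" "1 / Q ^ k = r ^ k" "1 / P = p" "1 / Q = r" for k
    by (simp_all add: p_def r_def power_divide)
  have e2: "1 / (P * Q) ^ 2 = p^2 * r^2" "7 / (P * Q) = 7 * p * r" "1 / (P / Q) ^ 2 = p ^ 2 * Q ^ 2" "7 / (P / Q) = 7 * p * Q"
    by (simp_all add: p_def r_def power_divide power_mult_distrib)
  have e3: "P / Q = P * r" by (simp add: r_def)
  show ?thesis unfolding T_def e2 unfolding e e3 using pr by algebra
qed

text \<open>For $x = w_1$ and $y = w_7$ the common value is $t = q^{-7/2} (f_7/f_{21})^6$.\<close>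

lemma elimination_identity:
  fixes x y t gx gy :: complex
  assumes nz: "x \<noteq> 0" "y \<noteq> 0" "t \<noteq> 0"
    and gx: "x ^ 3 * t + 27 / (x ^ 3 * t) = gx"
    and gy: "t / y ^ 3 + 27 / (t / y ^ 3) = gy"
  shows "gx * gy * ((x * y) ^ 3 + 1 / (x * y) ^ 3) - gx ^ 2 - gy ^ 2
           - 27 * ((x * y) ^ 3 - 1 / (x * y) ^ 3) ^ 2 = 0"
proof -
  \<comment> \<open>With R = a/c = (xy)^3, the equations gx = a + 27/a and gy = c + 27/c imply gx gy
    (R + 1/R) - gx^2 - gy^2 = 27 (R - 1/R)^2, from which t has disappeared.\<close>
  define a c where "a = x ^ 3 * t" and "c = t / y ^ 3"
  define a' c' where "a' = 1 / a" and "c' = 1 / c"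
  have ac: "a * a' = 1" "c * c' = 1" using nz by (simp_all add: a_def c_def a'_def c'_def)
  have g: "gx = a + 27 * a'" "gy = c + 27 * c'" using gx gy by (simp_all add: a_def c_def a'_def c'_def)
  have "(x * y) ^ 3 = a * c'" "1 / (x * y) ^ 3 = c * a'"
    using nz by (simp_all add: a_def c_def a'_def c'_def power_mult_distrib field_simps)
  thus ?thesis unfolding g using ac by (simp only:) algebra
qed

lemma norm_level21_form:
  "norm (level21_form \<tau>) = exp (- (20 * pi / 3) * Im \<tau>) * norm (level21_series (exp (2 * pi * \<i> * \<tau>)))"
proof -
  define z where "z = exp (pi * \<i> * \<tau> / 12)"
  define q where "q = exp (2 * pi * \<i> * \<tau>)"
  have zk: "exp (pi * \<i> * (of_nat k * \<tau>) / 12) = z ^ k" for k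
    unfolding z_def exp_of_nat_mult [symmetric] by (rule arg_cong[where f = exp]) simp
  have qk: "exp (2 * pi * \<i> * (of_nat k * \<tau>)) = q ^ k" for k
    unfolding q_def exp_of_nat_mult [symmetric] by (rule arg_cong[where f = exp]) simp
  have eta: "eta (of_nat k * \<tau>) = z ^ k * ram_f (q ^ k)" for k
    unfolding eta_def zk qk ..
  have q: "q = z ^ 24"
    unfolding z_def q_def exp_of_nat_mult [symmetric] by (rule arg_cong[where f = exp]) simp
  have "level21_form \<tau> = z ^ 80 * level21_series q"
    unfolding level21_form_def using eta[of 1] eta[of 3] eta[of 7] eta[of 21]
    by (simp add: eta_form_weights level21_series_def Let_def q flip: power_mult)
  moreover have "norm z ^ 80 = exp (- (20 * pi / 3) * Im \<tau>)"
    by (simp add: z_def flip: exp_of_nat_mult)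
  ultimately show ?thesis by (simp add: norm_mult norm_power q_def)
qed

lemma holomorphic_quotient_level21_series:
  obtains K where "K holomorphic_on ball 0 1" "\<And>q. norm q < 1 \<Longrightarrow> level21_series q = q ^ 13 * K q"
  using trunc13_level21_series unfolding trunc13_def by auto

text \<open>The maximum of y^4 e^(-c y) is at y = 4/c. The comparison beyond it uses y2/y1 <=
  exp((y2 - y1)/y1).\<close>

lemma weight_decay_less:
  fixes y1 y2 c :: real
  assumes "0 < y1" "y1 < y2" "4 / y1 < c"
  shows "y2 ^ 4 * exp (- c * y2) < y1 ^ 4 * exp (- c * y1)"
proof -
  have "y2 / y1 = 1 + (y2 - y1) / y1" using assms(1) by (simp add: field_simps)
  also have "\<dots> \<le> exp ((y2 - y1) / y1)" by (rule exp_ge_add_one_self)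
  finally have "(y2 / y1) ^ 4 \<le> exp ((y2 - y1) / y1) ^ 4"
    using assms by (intro power_mono) auto
  also have "\<dots> = exp (4 / y1 * (y2 - y1))" by (simp flip: exp_of_nat_mult)
  also have "\<dots> < exp (c * (y2 - y1))"
    unfolding exp_less_cancel_iff using assms by (intro mult_strict_right_mono) auto
  also have "\<dots> = exp (- c * y1) / exp (- c * y2)" by (simp add: algebra_simps flip: exp_diff)
  finally show ?thesis using assms(1) by (simp add: power_divide field_simps)
qed

text \<open>The form is $q^{49/3} K(q)$ with \<open>K\<close> holomorphic. The maximum of \<open>K\<close> on the disc
  corresponding to height at least $0.039$ is attained at height exactly $0.039$; such a point is equivalent to one
  of height at least $0.04$, where the decay of the weight factor $y^4 e^{-98\pi y/3}$ forces a smaller value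
  unless $K = 0$.\<close>

lemma level21_series_eq_0:
  assumes "norm q < 1"
  shows "level21_series q = 0"
proof -
  obtain K where K: "K holomorphic_on ball 0 1" "\<And>q. norm q < 1 \<Longrightarrow> level21_series q = q ^ 13 * K q"
    using holomorphic_quotient_level21_series by blast
  define c where "c = 98 * pi / 3"
  have level21_norm_K: "level21_norm \<tau> = Im \<tau> ^ 4 * exp (- c * Im \<tau>) * norm (K (exp (2 * pi * \<i> * \<tau>)))" if "Im \<tau> > 0" for \<tau>
  proof -
    have "norm (exp (2 * pi * \<i> * \<tau>)) ^ 13 = exp (- (26 * pi) * Im \<tau>)"
      by (simp flip: exp_of_nat_mult)
    hence "norm (level21_form \<tau>) = exp (- (20 * pi / 3) * Im \<tau>) * exp (- (26 * pi) * Im \<tau>) * norm (K (exp (2 * pi * \<i> * \<tau>)))"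
      unfolding norm_level21_form K(2)[OF norm_nome_less[OF that]] norm_mult norm_power by (simp only: mult.assoc)
    also have "exp (- (20 * pi / 3) * Im \<tau>) * exp (- (26 * pi) * Im \<tau>) = exp (- c * Im \<tau>)"
      unfolding exp_add [symmetric] by (rule arg_cong[where f = exp]) (simp add: c_def algebra_simps)
    finally show ?thesis by (simp add: level21_norm_def)
  qed
  \<comment> \<open>The value must lie below the guaranteed height 0.04 and above 4/c = 12/(98 pi) =
    0.03898, where the weight factor starts to decrease.\<close>
  define y where "y = (0.039 :: real)"
  define r where "r = exp (- 2 * pi * y)"
  have r: "0 < r" "r < 1" by (simp_all add: r_def y_def)
  have contK: "continuous_on (cball 0 r) K"
    using r by (intro continuous_on_subset[OF holomorphic_on_imp_continuous_on[OF K(1)]]) auto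
  have "continuous_on (sphere 0 r) (\<lambda>q. norm (K q))"
    by (intro continuous_intros continuous_on_subset[OF contK]) auto
  moreover have "sphere (0 :: complex) r \<noteq> {}" using r by simp
  ultimately obtain q1 where q1: "q1 \<in> sphere 0 r" "\<And>q. q \<in> sphere 0 r \<Longrightarrow> norm (K q) \<le> norm (K q1)"
    using continuous_attains_sup[of "sphere 0 r" "\<lambda>q. norm (K q)"] by auto
  have max: "norm (K q) \<le> norm (K q1)" if "norm q \<le> r" for q
  proof (rule maximum_modulus_frontier[of K "cball 0 r"])
    show "K holomorphic_on interior (cball 0 r)"
      using r by (intro holomorphic_on_subset[OF K(1)]) auto
    show "continuous_on (closure (cball 0 r)) K" using contK by simp
    show "norm (K z) \<le> norm (K q1)" if "z \<in> frontier (cball 0 r)" for z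
      using that r by (intro q1(2)) (auto simp: frontier_cball)
  qed (use that in auto)
  have "norm q1 = r" using q1(1) by simp
  then obtain \<tau>1 where \<tau>1: "Im \<tau>1 > 0" "exp (2 * pi * \<i> * \<tau>1) = q1"
    using exists_nome[of q1] r by (metis norm_zero less_irrefl)
  have "exp (- 2 * pi * Im \<tau>1) = r" using norm_nome[of \<tau>1] \<open>norm q1 = r\<close> unfolding \<tau>1(2) by simp
  hence Im1: "Im \<tau>1 = y" unfolding r_def by simp
  obtain \<tau>2 where \<tau>2: "level21_norm \<tau>2 = level21_norm \<tau>1" "Im \<tau>2 \<ge> 0.04"
    using level21_norm_reduction[OF \<tau>1(1)] .
  have "y < Im \<tau>2" using \<tau>2(2) by (simp add: y_def)
  have "norm (exp (2 * pi * \<i> * \<tau>2)) \<le> r"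
    unfolding norm_nome r_def using \<open>y < Im \<tau>2\<close> by simp
  hence "norm (K (exp (2 * pi * \<i> * \<tau>2))) \<le> norm (K q1)" by (rule max)
  hence "level21_norm \<tau>2 \<le> Im \<tau>2 ^ 4 * exp (- c * Im \<tau>2) * norm (K q1)"
    using \<tau>2(2) by (subst level21_norm_K) (auto intro!: mult_left_mono)
  moreover have "level21_norm \<tau>2 = y ^ 4 * exp (- c * y) * norm (K q1)"
    unfolding \<tau>2(1) level21_norm_K[OF \<tau>1(1)] \<tau>1(2) Im1 ..
  moreover have "Im \<tau>2 ^ 4 * exp (- c * Im \<tau>2) < y ^ 4 * exp (- c * y)"
    by (rule weight_decay_less) (use \<open>y < Im \<tau>2\<close> pi_approx(1) in \<open>auto simp: y_def c_def\<close>)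
  ultimately have "norm (K q1) \<le> 0"
    by (metis mult_le_cancel_right not_le)
  hence K0: "K z = 0" if "z \<in> ball 0 r" for z using max[of z] that by auto
  have "K q = 0"
  proof (rule analytic_continuation_open[of "ball 0 r" "ball 0 1" K "\<lambda>_. 0"])
    show "ball (0 :: complex) r \<noteq> {}" using r by simp
  qed (use K(1) K0 r assms in auto)
  thus ?thesis using K(2)[OF assms] by simp
qed

section \<open>Elimination and analytic continuation\<close>

text \<open>Division of the vanishing form by s^4 (abcd)^4, where s is q^(1/2). The four series
  values are left abstract because the relation is applied both at q with s and at q^7 with
  s^7.\<close>

lemma eta_quotient_relation:
  fixes a b c d s :: complex
  assumes nz: "a \<noteq> 0" "b \<noteq> 0" "c \<noteq> 0" "d \<noteq> 0" "s \<noteq> 0"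
    and G: "a^7 * c^7 * b * d + 27 * ((s^2)^4 * (a * c * b^7 * d^7)) - b^8 * c^8
     + 7 * (s^2 * (b^6 * c^6 * a^2 * d^2)) - 7 * ((s^2)^3 * (a^6 * d^6 * b^2 * c^2)) + (s^2)^4 * (a^8 * d^8) = 0"
  defines "X \<equiv> s * (a * d) / (b * c)" and "U \<equiv> (a * c / (b * d)) ^ 3 / s ^ 4"
  shows "U + 27 / U = 1 / (X^2)^2 - 7 / X^2 + 7 * X^2 - (X^2)^2"
proof -
  define Z where "Z = s^4 * (a * b * c * d) ^ 4"
  have Z: "Z \<noteq> 0" using nz by (simp add: Z_def)
  have "U * Z = a^7 * c^7 * b * d" "27 / U * Z = 27 * ((s^2)^4 * (a * c * b^7 * d^7))"
    "1 / (X^2)^2 * Z = b^8 * c^8" "7 / X^2 * Z = 7 * (s^2 * (b^6 * c^6 * a^2 * d^2))"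
    "7 * X^2 * Z = 7 * ((s^2)^3 * (a^6 * d^6 * b^2 * c^2))" "(X^2)^2 * Z = (s^2)^4 * (a^8 * d^8)"
    using nz by (simp_all add: U_def X_def Z_def field_simps power_mult_distrib eval_nat_numeral)
  hence "(U + 27 / U - (1 / (X^2)^2 - 7 / X^2 + 7 * X^2 - (X^2)^2)) * Z = 0"
    using G by (simp only: ring_distribs) (simp add: algebra_simps)
  thus ?thesis using Z by simp
qed

text \<open>As a function of s with q = s^2, so that the half-integral powers are single-valued and
  the continuation can be done in the disc of s.\<close>

definition P21 :: "complex \<Rightarrow> complex" where
  "P21 s = w_quot (s^2) s 1 * w_quot (s^2) s 7"

definition Q21 :: "complex \<Rightarrow> complex" where
  "Q21 s = w_quot (s^2) s 1 / w_quot (s^2) s 7"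

definition PQ_defect :: "complex \<Rightarrow> complex \<Rightarrow> complex" where
  "PQ_defect P Q = P ^ 6 + 1 / P ^ 6 + Q ^ 4 + 1 / Q ^ 4 -
     (49 * (Q ^ 2 + 1 / Q ^ 2) - 28 * (Q + 1 / Q) - 464
    + (P ^ 5 + 1 / P ^ 5) * (29 + 7 * (Q + 1 / Q))
    - (P ^ 4 + 1 / P ^ 4) * (106 + 14 * (Q + 1 / Q))
    + (P ^ 3 + 1 / P ^ 3) *
        (183 + 21 * (Q + 1 / Q) - 7 * (Q ^ 3 + 1 / Q ^ 3) + (Q ^ 4 + 1 / Q ^ 4))
    - (P ^ 2 + 1 / P ^ 2) *
        (260 + 28 * (Q + 1 / Q) - 49 * (Q ^ 2 + 1 / Q ^ 2) + (Q ^ 4 + 1 / Q ^ 4))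
    + (P + 1 / P) *
        (337 + 35 * (Q + 1 / Q) - 49 * (Q ^ 2 + 1 / Q ^ 2) + (Q ^ 4 + 1 / Q ^ 4)))"

lemma ram_fn_nonzero:
  assumes "norm q < 1" "n > 0"
  shows "ram_fn q n \<noteq> 0"
  unfolding ram_fn_def by (rule ram_f_nonzero) (use assms in \<open>simp add: norm_power power_less_one_iff\<close>)

lemma w_quot_nonzero:
  assumes "norm q < 1" "s \<noteq> 0" "r > 0"
  shows "w_quot q s r \<noteq> 0"
  using assms by (simp add: w_quot_def ram_fn_nonzero)

text \<open>At q the relation involves the series with indices 1, 3, 7, 21, at q^7 those with 7, 21,
  49, 147. The overlap f 7, f 21 forms the quantity t that is eliminated.\<close>

lemma PQ_defect_eq_0_weak:
  assumes s: "s \<noteq> 0" "norm s < 1"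
  shows "(P21 s + 1) ^ 2 * PQ_defect (P21 s) (Q21 s) = 0"
proof -
  define q where "q = s ^ 2"
  have q: "norm q < 1" "norm (q ^ 7) < 1" using s by (simp_all add: q_def norm_power power_less_one_iff)
  define f where "f = ram_fn q"
  have f: "f n \<noteq> 0" if "n > 0" for n unfolding f_def using q(1) that by (rule ram_fn_nonzero)
  define x y where "x = w_quot q s 1" and "y = w_quot q s 7"
  have x: "x = s * (f 1 * f 21) / (f 3 * f 7)" by (simp add: x_def w_quot_def f_def)
  have y: "y = s ^ 7 * (f 7 * f 147) / (f 21 * f 49)" by (simp add: y_def w_quot_def f_def)
  have nz: "x \<noteq> 0" "y \<noteq> 0" using s f by (simp_all add: x y)
  define t where "t = f 7 ^ 6 / (f 21 ^ 6 * s ^ 7)"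
  have t: "t \<noteq> 0" using s f by (simp add: t_def)
  define g where "g = (\<lambda>w::complex. 1 / w^2 - 7 / w + 7 * w - w^2)"
  have "(f 1 * f 7 / (f 3 * f 21)) ^ 3 / s ^ 4 + 27 / ((f 1 * f 7 / (f 3 * f 21)) ^ 3 / s ^ 4) = g (x ^ 2)"
    unfolding g_def x
    by (rule eta_quotient_relation)
       (use f s ram_f_nonzero[OF q(1)] level21_series_eq_0[OF q(1)] in \<open>simp_all add: level21_series_def Let_def f_def ram_fn_def flip: q_def\<close>)
  moreover have "(f 1 * f 7 / (f 3 * f 21)) ^ 3 / s ^ 4 = x ^ 3 * t"
    using f s by (simp add: x t_def field_simps eval_nat_numeral)
  ultimately have gx: "x ^ 3 * t + 27 / (x ^ 3 * t) = g (x ^ 2)" by (simp only:)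
  have s_q: "s ^ 14 = q ^ 7" "s ^ 42 = q ^ 21" "s ^ 56 = q ^ 28"
    by (simp_all add: q_def flip: power_mult)
  have "(f 7 * f 49 / (f 21 * f 147)) ^ 3 / (s ^ 7) ^ 4 + 27 / ((f 7 * f 49 / (f 21 * f 147)) ^ 3 / (s ^ 7) ^ 4) = g (y ^ 2)"
    unfolding g_def y
    by (rule eta_quotient_relation)
       (use f s level21_series_eq_0[OF q(2)] in \<open>simp_all add: level21_series_def Let_def f_def ram_fn_def s_q flip: power_mult\<close>)
  moreover have "(f 7 * f 49 / (f 21 * f 147)) ^ 3 / (s ^ 7) ^ 4 = t / y ^ 3"
    using f s by (simp add: y t_def field_simps eval_nat_numeral)
  ultimately have gy: "t / y ^ 3 + 27 / (t / y ^ 3) = g (y ^ 2)" by (simp only:)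
  define P Q where "P = x * y" and "Q = x / y"
  have PQ: "P \<noteq> 0" "Q \<noteq> 0" using nz by (simp_all add: P_def Q_def)
  have x2: "x ^ 2 = P * Q" and y2: "y ^ 2 = P / Q"
    using nz by (simp_all add: P_def Q_def power2_eq_square)
  have "(P + 1) ^ 2 * PQ_defect P Q = P * (g (P * Q) * g (P / Q) * (P ^ 3 + 1 / P ^ 3)
            - g (P * Q) ^ 2 - g (P / Q) ^ 2 - 27 * (P ^ 3 - 1 / P ^ 3) ^ 2)"
    unfolding g_def PQ_defect_def by (rule factorization_identity[OF PQ, symmetric])
  also have "\<dots> = 0"
    using elimination_identity[OF nz t gx gy] unfolding x2 y2 P_def [symmetric] by simp
  finally show ?thesis unfolding P_def Q_def P21_def Q21_def x_def y_def q_def .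
qed

lemma holomorphic_ram_fn_square:
  assumes "n > 0"
  shows "(\<lambda>s. ram_fn (s^2) n) holomorphic_on ball 0 1"
  using holomorphic_power_map[OF _ holomorphic_ram_f, of "2 * n"] assms
  by (simp add: ram_fn_def power_mult)

lemma holomorphic_w_quot:
  assumes "r > 0"
  shows "(\<lambda>s. w_quot (s^2) s r) holomorphic_on ball 0 1"
  unfolding w_quot_def
  by (intro holomorphic_intros holomorphic_ram_fn_square)
     (use assms in \<open>auto simp: ram_fn_nonzero norm_power power_less_one_iff\<close>)

text \<open>The factor P + 1 is controlled only near s = 0, where the explicit powers of s make P
  tend to 0. The defect contains 1/P and 1/Q, so the continuation takes place on the punctured disc,
  which is still connected.\<close>

lemma PQ_defect_eq_0:
  assumes s: "s \<noteq> 0" "norm s < 1"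
  shows "PQ_defect (P21 s) (Q21 s) = 0"
proof -
  define D where "D = ball (0 :: complex) 1 - {0}"
  note w_hol = holomorphic_on_subset[OF holomorphic_w_quot, of _ D]
  have nz: "w_quot (s^2) s r \<noteq> 0" if "s \<in> D" "r > 0" for s r
    using that by (intro w_quot_nonzero) (auto simp: D_def norm_power power_less_one_iff)
  have P: "P21 holomorphic_on D" "\<And>s. s \<in> D \<Longrightarrow> P21 s \<noteq> 0"
    unfolding P21_def[abs_def] by (auto intro!: holomorphic_intros w_hol simp: nz D_def [symmetric]) (auto simp: D_def)
  have Q: "Q21 holomorphic_on D" "\<And>s. s \<in> D \<Longrightarrow> Q21 s \<noteq> 0"
    unfolding Q21_def[abs_def] by (auto intro!: holomorphic_intros w_hol simp: nz D_def [symmetric]) (auto simp: D_def)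
  have hol: "(\<lambda>s. PQ_defect (P21 s) (Q21 s)) holomorphic_on D"
    unfolding PQ_defect_def by (intro holomorphic_intros P Q) (use P(2) Q(2) in auto)
  have "P21 holomorphic_on ball 0 1"
    unfolding P21_def[abs_def] by (intro holomorphic_intros holomorphic_w_quot) auto
  hence "continuous_on (ball 0 1) P21" by (rule holomorphic_on_imp_continuous_on)
  hence "isCont P21 0" by (simp add: continuous_on_eq_continuous_at)
  hence "(P21 \<longlongrightarrow> P21 0) (nhds 0)" unfolding isCont_def tendsto_at_iff_tendsto_nhds .
  moreover have "P21 0 \<noteq> -1" by (simp add: P21_def w_quot_def)
  ultimately have "eventually (\<lambda>s. P21 s \<noteq> -1) (nhds 0)" by (rule tendsto_imp_eventually_ne)
  then obtain e where e: "e > 0" "\<And>s. dist s 0 < e \<Longrightarrow> P21 s \<noteq> -1"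
    unfolding eventually_nhds_metric by blast
  define N where "N = ball 0 (min e 1) - {0 :: complex}"
  show ?thesis
  proof (rule analytic_continuation_open[of N D "\<lambda>s. PQ_defect (P21 s) (Q21 s)" "\<lambda>_. 0"])
    show "open N" "open D" by (auto simp: N_def D_def)
    have "complex_of_real (min e 1 / 2) \<in> N" using e(1) by (auto simp: N_def)
    thus "N \<noteq> {}" by blast
    show "connected D" unfolding D_def by (intro connected_open_delete) auto
    show "N \<subseteq> D" by (auto simp: N_def D_def)
    show "PQ_defect (P21 z) (Q21 z) = 0" if "z \<in> N" for z
    proof -
      have "P21 z \<noteq> -1" using that by (intro e(2)) (auto simp: N_def)
      hence "P21 z + 1 \<noteq> 0" by (simp add: add_eq_0_iff2)
      thus ?thesis using PQ_defect_eq_0_weak[of z] that by (auto simp: N_def)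
    qed
  qed (use hol s in \<open>auto simp: D_def\<close>)
qed

theorem theorem3p8:
  fixes q s P Q :: complex
  assumes "0 < norm q" and "norm q < 1"
    and "s ^ 2 = q"
    and "\<And>x::real. 0 < x \<Longrightarrow> q = of_real x \<Longrightarrow> s = of_real (sqrt x)"
    and "P = w_quot q s 1 * w_quot q s 7"
    and "Q = w_quot q s 1 / w_quot q s 7"
  shows "P ^ 6 + 1 / P ^ 6 + Q ^ 4 + 1 / Q ^ 4 =
      49 * (Q ^ 2 + 1 / Q ^ 2) - 28 * (Q + 1 / Q) - 464
    + (P ^ 5 + 1 / P ^ 5) * (29 + 7 * (Q + 1 / Q))
    - (P ^ 4 + 1 / P ^ 4) * (106 + 14 * (Q + 1 / Q))
    + (P ^ 3 + 1 / P ^ 3) *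
        (183 + 21 * (Q + 1 / Q) - 7 * (Q ^ 3 + 1 / Q ^ 3) + (Q ^ 4 + 1 / Q ^ 4))
    - (P ^ 2 + 1 / P ^ 2) *
        (260 + 28 * (Q + 1 / Q) - 49 * (Q ^ 2 + 1 / Q ^ 2) + (Q ^ 4 + 1 / Q ^ 4))
    + (P + 1 / P) *
        (337 + 35 * (Q + 1 / Q) - 49 * (Q ^ 2 + 1 / Q ^ 2) + (Q ^ 4 + 1 / Q ^ 4))"
proof -
  have "s \<noteq> 0" using assms(1,3) by auto
  moreover have "norm s < 1"
    using assms(2) unfolding assms(3) [symmetric] by (simp add: norm_power power_less_one_iff)
  moreover have "P = P21 s" "Q = Q21 s"
    using assms(5,6) unfolding P21_def Q21_def assms(3) by blast+
  ultimately have "PQ_defect P Q = 0" using PQ_defect_eq_0 by simp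
  thus ?thesis unfolding PQ_defect_def by (rule iffD2[OF eq_iff_diff_eq_0])
qed

end
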